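(* Let $q\in(1,2)$ be a root of a nonzero polynomial with coefficients in $\{-1,0,1\}$. If $q$ is not a Perron number, then $l(q)=0$. If, in addition, $q<\sqrt2$ and $-q$ is not an algebraic conjugate of $q$, then $L(q)=0$.
   Context: For $q\in(1,2)$ let $Y_n(q)=\{\sum_{k=0}^{n} a_kq^k : a_k\in\{0,1\}\}$ and $Y(q)=\bigcup_{n\ge1}Y_n(q)$. The set $Y(q)$ is discrete, and its elements are written in ascending order as $0=y_0(q)<y_1(q)<y_2(q)<\cdots$. Define $l(q)=\liminf_{n\to\infty}(y_{n+1}(q)-y_n(q))$ and $L(q)=\limsup_{n\to\infty}(y_{n+1}(q)-y_n(q))$. The conjugates of an algebraic number $q$ are the complex roots of its minimal polynomial over $\mathbb{Q}$. An algebraic integer $q>1$ is called a Perron number if each of its conjugates other than $q$ itself is strictly less than $q$ in modulus. *)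

theory Defs
  imports "HOL-Analysis.Analysis" "HOL-Computational_Algebra.Computational_Algebra"
begin

definition spec_level :: "nat \<Rightarrow> real \<Rightarrow> real set" where
  "spec_level n q = {\<Sum>k\<le>n. a k * q ^ k | a :: nat \<Rightarrow> real. \<forall>k\<le>n. a k \<in> {0, 1}}"

definition spec :: "real \<Rightarrow> real set" where
  "spec q = (\<Union>n\<in>{1..}. spec_level n q)"

text \<open>
  For \<open>q > 1\<close> the set \<open>spec q\<close> has finitely many elements below any bound and is unbounded, so
  each minimum taken below exists; \<open>strict_mono_spec_enum\<close> and \<open>range_spec_enum\<close> confirm that
  \<open>spec_enum q\<close> is the ascending enumeration of \<open>spec q\<close>.
\<close>

primrec spec_enum :: "real \<Rightarrow> nat \<Rightarrow> real" where
  "spec_enum q 0 = 0"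
| "spec_enum q (Suc n) = (LEAST x. x \<in> spec q \<and> spec_enum q n < x)"

definition gap_liminf :: "real \<Rightarrow> ereal" where
  "gap_liminf q = liminf (\<lambda>n. ereal (spec_enum q (Suc n) - spec_enum q n))"

definition gap_limsup :: "real \<Rightarrow> ereal" where
  "gap_limsup q = limsup (\<lambda>n. ereal (spec_enum q (Suc n) - spec_enum q n))"

definition is_min_poly :: "complex \<Rightarrow> rat poly \<Rightarrow> bool" where
  "is_min_poly z p \<longleftrightarrow> lead_coeff p = 1 \<and> poly (map_poly of_rat p) z = 0 \<and>
     (\<forall>r. r \<noteq> 0 \<and> poly (map_poly of_rat r) z = 0 \<longrightarrow> degree p \<le> degree r)"

text \<open>Only meaningful for algebraic \<open>z\<close>; see \<open>ex1_is_min_poly\<close>.\<close>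

definition min_poly :: "complex \<Rightarrow> rat poly" where
  "min_poly z = (THE p. is_min_poly z p)"

definition conjugates :: "complex \<Rightarrow> complex set" where
  "conjugates z = {w. poly (map_poly of_rat (min_poly z)) w = 0}"

definition perron_number :: "real \<Rightarrow> bool" where
  "perron_number q \<longleftrightarrow> algebraic_int q \<and> q > 1 \<and>
     (\<forall>w\<in>conjugates (complex_of_real q). w \<noteq> complex_of_real q \<longrightarrow> cmod w < q)"


lemma poly_map_of_rat_diff:
  "poly (map_poly of_rat (p - r)) (z :: complex) =
   poly (map_poly of_rat p) z - poly (map_poly of_rat r) z"
proof -
  have "map_poly of_rat (p - r) = (map_poly of_rat p - map_poly of_rat r :: complex poly)"
    by (rule poly_eqI) (simp add: coeff_map_poly of_rat_diff)
  then show ?thesis by simp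
qed

lemma poly_map_of_rat_smult:
  "poly (map_poly of_rat (smult c p)) (z :: complex) = of_rat c * poly (map_poly of_rat p) z"
proof -
  have "map_poly of_rat (smult c p) = (smult (of_rat c) (map_poly of_rat p) :: complex poly)"
    by (rule poly_eqI) (simp add: coeff_map_poly of_rat_mult)
  then show ?thesis by simp
qed

lemma ex1_is_min_poly:
  assumes "algebraic z"
  shows "\<exists>!p. is_min_poly z p"
proof -
  from assms obtain P :: "complex poly"
    where P: "\<forall>i. coeff P i \<in> \<int>" "P \<noteq> 0" "poly P z = 0"
    unfolding algebraic_def by blast
  from P(1) have "\<forall>i. \<exists>c::int. coeff P i = of_int c" by (auto elim: Ints_cases)
  then obtain c :: "nat \<Rightarrow> int" where c: "\<And>i. coeff P i = of_int (c i)" by metis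
  define R :: "rat poly" where "R = (\<Sum>i\<le>degree P. monom (of_int (c i)) i)"
  have cR: "coeff R i = (if i \<le> degree P then of_int (c i) else 0)" for i
    by (simp add: R_def coeff_sum coeff_monom)
  have RP: "map_poly of_rat R = P"
    by (rule poly_eqI) (use c coeff_eq_0[of P] in \<open>auto simp: coeff_map_poly cR\<close>)
  let ?Q = "\<lambda>r :: rat poly. r \<noteq> 0 \<and> poly (map_poly of_rat r) z = 0"
  have "?Q R" using RP P by auto
  then obtain r where r: "?Q r" "\<And>s. ?Q s \<Longrightarrow> degree r \<le> degree s"
    using ex_has_least_nat[of ?Q R degree] by blast
  define p where "p = smult (inverse (lead_coeff r)) r"
  have "is_min_poly z p"
    unfolding is_min_poly_def using r by (auto simp: p_def poly_map_of_rat_smult)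
  moreover have "p1 = p2" if p1: "is_min_poly z p1" and p2: "is_min_poly z p2" for p1 p2
  proof (rule ccontr)
    assume "p1 \<noteq> p2"
    have nz: "p1 \<noteq> 0" "p2 \<noteq> 0" using p1 p2 by (auto simp: is_min_poly_def)
    have deg: "degree p1 = degree p2"
      using p1 p2 nz unfolding is_min_poly_def by (meson le_antisym)
    have "?Q (p1 - p2)"
      using p1 p2 \<open>p1 \<noteq> p2\<close> by (auto simp: is_min_poly_def poly_map_of_rat_diff)
    then have "degree p1 \<le> degree (p1 - p2)" using p1 by (auto simp: is_min_poly_def)
    moreover have "degree (p1 - p2) \<le> degree p1"
      using deg degree_diff_le by (metis order_refl)
    ultimately have "lead_coeff (p1 - p2) = coeff p1 (degree p1) - coeff p2 (degree p2)"
      using deg by simp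
    also have "\<dots> = 0" using p1 p2 by (simp add: is_min_poly_def)
    finally show False using \<open>p1 \<noteq> p2\<close> leading_coeff_0_iff[of "p1 - p2"] by (metis eq_iff_diff_eq_0)
  qed
  ultimately show ?thesis by blast
qed

lemma finite_spec_atMost:
  assumes "q > 1"
  shows "finite {x \<in> spec q. x \<le> M}"
proof -
  obtain K where K: "M < q ^ K" using real_arch_pow[OF assms] by blast
  have "{x \<in> spec q. x \<le> M} \<subseteq> (\<lambda>S. \<Sum>k\<in>S. q ^ k) ` Pow {..K}"
  proof
    fix x assume "x \<in> {x \<in> spec q. x \<le> M}"
    then obtain n a where x: "x = (\<Sum>k\<le>n. a k * q ^ k)" and a: "\<forall>k\<le>n. a k \<in> {0, 1 :: real}"
      and M: "x \<le> M"
      by (auto simp: spec_def spec_level_def)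
    define S where "S = {k. k \<le> n \<and> a k = 1}"
    have "x = (\<Sum>k\<in>S. a k * q ^ k)"
      unfolding x by (rule sum.mono_neutral_right) (use a in \<open>auto simp: S_def\<close>)
    then have xS: "x = (\<Sum>k\<in>S. q ^ k)" by (simp add: S_def)
    have "k \<le> K" if "k \<in> S" for k
    proof (rule ccontr)
      assume "\<not> k \<le> K"
      then have "q ^ K \<le> q ^ k" using assms by (intro power_increasing) auto
      also have "\<dots> \<le> x" unfolding xS
        by (rule member_le_sum) (use that assms in \<open>auto simp: S_def\<close>)
      finally show False using K M by simp
    qed
    then show "x \<in> (\<lambda>S. \<Sum>k\<in>S. q ^ k) ` Pow {..K}" using xS by auto
  qed
  then show ?thesis by (rule finite_subset) auto
qed

lemma zero_in_spec: "0 \<in> spec q"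
  unfolding spec_def spec_level_def by (auto intro!: bexI[of _ 1] exI[of _ "\<lambda>_. 0"])

lemma spec_nonneg:
  assumes "q > 1" "x \<in> spec q"
  shows "x \<ge> 0"
  using assms by (fastforce simp: spec_def spec_level_def intro!: sum_nonneg)

lemma spec_unbounded:
  assumes "q > 1"
  shows "\<exists>x\<in>spec q. M < x"
proof -
  obtain K where K: "M < q ^ K" using real_arch_pow[OF assms] by blast
  have "(\<Sum>k\<le>Suc K. (if k = K then 1 else 0) * q ^ k) = (\<Sum>k\<le>Suc K. if k = K then q ^ k else 0)"
    by (rule sum.cong) auto
  also have "\<dots> = q ^ K" by (subst sum.delta) auto
  finally have "q ^ K \<in> spec_level (Suc K) q"
    unfolding spec_level_def by (auto intro!: exI[of _ "\<lambda>k. if k = K then 1 else 0"])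
  then show ?thesis using K by (auto simp: spec_def intro!: bexI[of _ "q ^ K"] bexI[of _ "Suc K"])
qed

lemma spec_next:
  fixes q M :: real
  assumes "q > 1"
  defines "s \<equiv> (LEAST x. x \<in> spec q \<and> M < x)"
  shows "s \<in> spec q" "M < s" "\<And>x. x \<in> spec q \<Longrightarrow> M < x \<Longrightarrow> s \<le> x"
proof -
  obtain b where b: "b \<in> spec q" "M < b" using spec_unbounded[OF assms(1)] by blast
  let ?A = "{x \<in> spec q. M < x \<and> x \<le> b}"
  have fin: "finite ?A" by (rule finite_subset[OF _ finite_spec_atMost[OF assms(1), of b]]) auto
  have ne: "?A \<noteq> {}" using b by auto
  have "Min ?A \<in> ?A" using Min_in[OF fin ne] .
  moreover have least: "Min ?A \<le> x" if "x \<in> spec q" "M < x" for x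
  proof (cases "x \<le> b")
    case True
    then show ?thesis using that fin by (intro Min_le) auto
  next
    case False
    then show ?thesis using \<open>Min ?A \<in> ?A\<close> by auto
  qed
  ultimately have "s = Min ?A" unfolding s_def by (intro Least_equality) auto
  then show "s \<in> spec q" "M < s" "\<And>x. x \<in> spec q \<Longrightarrow> M < x \<Longrightarrow> s \<le> x"
    using \<open>Min ?A \<in> ?A\<close> least by auto
qed

lemma strict_mono_spec_enum:
  assumes "q > 1"
  shows "strict_mono (spec_enum q)"
  unfolding strict_mono_Suc_iff using spec_next(2)[OF assms] by simp

lemma range_spec_enum:
  assumes "q > 1"
  shows "range (spec_enum q) = spec q"
proof
  show sub: "range (spec_enum q) \<subseteq> spec q"
  proof clarify
    fix n show "spec_enum q n \<in> spec q"
      by (cases n) (auto simp: zero_in_spec spec_next(1)[OF assms])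
  qed
  show "spec q \<subseteq> range (spec_enum q)"
  proof (rule subsetI, rule ccontr)
    fix x assume x: "x \<in> spec q" "x \<notin> range (spec_enum q)"
    have "spec_enum q n < x" for n
    proof (induction n)
      case 0
      have "x \<noteq> spec_enum q 0" using x(2) by blast
      then show ?case using spec_nonneg[OF assms x(1)] by simp
    next
      case (Suc n)
      have "spec_enum q (Suc n) \<le> x" using spec_next(3)[OF assms x(1) Suc] by simp
      then show ?case using x(2) by (metis order_le_less rangeI)
    qed
    then have "range (spec_enum q) \<subseteq> {y \<in> spec q. y \<le> x}" using sub by (auto intro: less_imp_le)
    then have "finite (range (spec_enum q))"
      using finite_spec_atMost[OF assms] finite_subset by blast
    moreover have "inj (spec_enum q)"
      using strict_mono_spec_enum[OF assms] strict_mono_imp_inj_on by blast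
    ultimately show False using finite_imageD infinite_UNIV_nat by blast
  qed
qed

end

theory Submission
  imports Defs
begin

text \<open>
  Let \<open>D n w\<close> be the number of distinct sums of the form \<open>\<Sum>k\<in>S. w ^ k\<close> with \<open>S \<subseteq> {..n}\<close>. If \<open>D n q / q ^ n\<close> is
  unbounded, then by the pigeonhole principle \<open>spec q\<close> contains arbitrarily close pairs.

  If \<open>w\<close> is a root of a polynomial with coefficients in \<open>{-1, 0, 1}\<close> of degree \<open>N\<close>, then for \<open>n \<ge> N\<close> the
  sums with and without \<open>w ^ n\<close> overlap, so all sums can be joined by chains of bounded step and
  \<open>D n w\<close> grows at least like \<open>\<bar>w\<bar> ^ n\<close>. As \<open>D n\<close> agrees for conjugates, this settles the case of a
  conjugate of modulus larger than \<open>q\<close>. Otherwise let \<open>m \<ge> 2\<close> be the number of conjugates of modulus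
  \<open>q\<close>. Their product \<open>\<plusminus>q ^ m\<close> is the only product of \<open>m\<close> conjugates of its modulus, and the products of
  \<open>m\<close> conjugates are the roots of a rational polynomial; hence these \<open>m\<close> conjugates are precisely the
  \<open>m\<close>-th roots of \<open>\<beta> = q ^ m\<close>. It follows that \<open>\<beta>\<close> is again a root of a polynomial with coefficients in
  \<open>{-1, 0, 1}\<close> and that \<open>(y, y') \<mapsto> y + q * y'\<close> is injective on \<open>spec \<beta>\<close>, so \<open>D (m * n + 1) q\<close> is at
  least the square of \<open>D n \<beta>\<close>, which is of order \<open>q ^ (2 * m * n)\<close>.

  For the upper limit, the same argument yields close pairs in \<open>spec (q\<^sup>2)\<close>. Scaled by powers of
  \<open>q\<^sup>2\<close> with disjoint supports they produce arbitrarily long fine chains in \<open>spec (q\<^sup>2)\<close>, whose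
  translates by the elements of \<open>q * spec (q\<^sup>2)\<close>, which has gaps at most \<open>q\<close>, cover a half-line.
\<close>

subsection \<open>Sums of distinct powers\<close>

text \<open>Stated over any normed field, so that counts for \<open>q\<close> and for its complex
  conjugates can be compared. With subsets as indices, adding sums with disjoint supports is a
  disjoint union.\<close>

definition power_sums :: "nat \<Rightarrow> 'a::real_normed_field \<Rightarrow> 'a set" where
  "power_sums n w = (\<lambda>S. \<Sum>k\<in>S. w ^ k) ` Pow {..n}"

lemma finite_power_sums [simp]: "finite (power_sums n w)"
  by (simp add: power_sums_def)

lemma power_sumsI: "S \<subseteq> {..n} \<Longrightarrow> (\<Sum>k\<in>S. w ^ k) \<in> power_sums n w"
  by (auto simp: power_sums_def)

lemma power_sums_Suc:
  "power_sums (Suc n) w = power_sums n w \<union> (\<lambda>x. x + w ^ Suc n) ` power_sums n w"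
proof -
  have *: "(\<Sum>k\<in>insert (Suc n) S. w ^ k) = (\<Sum>k\<in>S. w ^ k) + w ^ Suc n" if "S \<subseteq> {..n}" for S
    using that finite_subset[OF that] by (subst sum.insert) auto
  show ?thesis
    unfolding power_sums_def atMost_Suc Pow_insert image_Un image_image
    by (intro arg_cong2[of _ _ _ _ "(\<union>)"] image_cong) (simp_all add: *)
qed

lemma spec_level_eq_power_sums: "spec_level n q = power_sums n q"
proof (intro set_eqI iffI)
  fix x assume "x \<in> spec_level n q"
  then obtain a where x: "x = (\<Sum>k\<le>n. a k * q ^ k)" and a: "\<forall>k\<le>n. a k \<in> {0, 1 :: real}"
    by (auto simp: spec_level_def)
  have "x = (\<Sum>k\<in>{k. k \<le> n \<and> a k = 1}. a k * q ^ k)"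
    unfolding x by (rule sum.mono_neutral_right) (use a in auto)
  then have "x = (\<Sum>k\<in>{k. k \<le> n \<and> a k = 1}. q ^ k)" by simp
  then show "x \<in> power_sums n q" by (auto simp: power_sums_def)
next
  fix x assume "x \<in> power_sums n q"
  then obtain S where S: "S \<subseteq> {..n}" and x: "x = (\<Sum>k\<in>S. q ^ k)"
    by (auto simp: power_sums_def)
  have "x = (\<Sum>k\<le>n. (if k \<in> S then 1 else 0) * q ^ k)"
    unfolding x by (rule sum.mono_neutral_cong_left) (use S in auto)
  then show "x \<in> spec_level n q"
    by (auto simp: spec_level_def intro!: exI[of _ "\<lambda>k. if k \<in> S then 1 else 0"])
qed

lemma mem_spec_iff: "x \<in> spec q \<longleftrightarrow> (\<exists>S. finite S \<and> x = (\<Sum>k\<in>S. q ^ k))"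
proof
  assume "x \<in> spec q"
  then show "\<exists>S. finite S \<and> x = (\<Sum>k\<in>S. q ^ k)"
    by (auto simp: spec_def spec_level_eq_power_sums power_sums_def intro: finite_subset)
next
  assume "\<exists>S. finite S \<and> x = (\<Sum>k\<in>S. q ^ k)"
  then obtain S where S: "finite S" "x = (\<Sum>k\<in>S. q ^ k)" by blast
  have "S \<subseteq> {..Suc (Max S)}" using S(1) by (auto intro: le_SucI)
  with S have "x \<in> spec_level (Suc (Max S)) q"
    by (auto simp: spec_level_eq_power_sums power_sums_def)
  then show "x \<in> spec q" by (auto simp: spec_def)
qed

lemma power_sums_subset_spec: "power_sums n q \<subseteq> spec q"
proof
  fix x assume "x \<in> power_sums n q"
  then obtain S where "S \<subseteq> {..n}" "x = (\<Sum>k\<in>S. q ^ k)" by (auto simp: power_sums_def)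
  then show "x \<in> spec q" unfolding mem_spec_iff by (intro exI[of _ S]) (auto intro: finite_subset)
qed

lemma card_power_sums_of_real:
  "card (power_sums n (complex_of_real q)) = card (power_sums n q)"
proof -
  have "power_sums n (complex_of_real q) = of_real ` power_sums n q"
    by (simp add: power_sums_def image_image)
  then show ?thesis by (simp add: card_image inj_on_def)
qed

text \<open>On \<open>A\<close> the map \<open>g\<close> factors through \<open>f\<close>, so
  \<open>g\<close> A\<open>is an image of\<close>f \<open>A\<close>.\<close>

lemma card_image_le_of_factor:
  assumes "finite A" "\<And>x y. x \<in> A \<Longrightarrow> y \<in> A \<Longrightarrow> f x = f y \<Longrightarrow> g x = g y"
  shows "card (g ` A) \<le> card (f ` A)"
proof -
  have "g x = g (inv_into A f (f x))" if "x \<in> A" for x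
    using that assms(2)[OF that inv_into_into[OF imageI[OF that]]] f_inv_into_f[OF imageI[OF that], of f] 
    by metis
  then have "g ` A = (\<lambda>y. g (inv_into A f y)) ` f ` A"
    unfolding image_image by (rule image_cong[OF refl])
  then show ?thesis using assms(1) by (simp add: card_image_le)
qed

subsection \<open>Chain-connected sets\<close>

text \<open>Encoded by closed subsets rather than by explicit paths, so that unions and translates
  need no concatenation of paths.\<close>

definition step_connected :: "real \<Rightarrow> 'a::real_normed_vector set \<Rightarrow> bool" where
  "step_connected c E \<longleftrightarrow>
     (\<forall>A\<subseteq>E. A \<noteq> {} \<and> (\<forall>a\<in>A. \<forall>b\<in>E. norm (a - b) \<le> c \<longrightarrow> b \<in> A) \<longrightarrow> A = E)"

lemma step_connectedD:
  assumes "step_connected c E" "A \<subseteq> E" "A \<noteq> {}"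
    "\<And>a b. a \<in> A \<Longrightarrow> b \<in> E \<Longrightarrow> norm (a - b) \<le> c \<Longrightarrow> b \<in> A"
  shows "A = E"
  using assms unfolding step_connected_def by blast

lemma step_connected_Un:
  assumes E: "step_connected c E" and F: "step_connected c F" and "E \<inter> F \<noteq> {}"
  shows "step_connected c (E \<union> F)"
  unfolding step_connected_def
proof (intro allI impI, elim conjE)
  fix A assume A: "A \<subseteq> E \<union> F" "A \<noteq> {}"
    and cl: "\<forall>a\<in>A. \<forall>b\<in>E \<union> F. norm (a - b) \<le> c \<longrightarrow> b \<in> A"
  have "A \<inter> E = E" if "A \<inter> E \<noteq> {}"
    by (rule step_connectedD[OF E]) (use that cl in auto)
  moreover have "A \<inter> F = F" if "A \<inter> F \<noteq> {}"
    by (rule step_connectedD[OF F]) (use that cl in auto)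
  ultimately show "A = E \<union> F" using A assms(3) by blast
qed

lemma step_connected_translate:
  assumes "step_connected c E"
  shows "step_connected c ((\<lambda>x. x + t) ` E)"
  unfolding step_connected_def
proof (intro allI impI, elim conjE)
  fix A assume A: "A \<subseteq> (\<lambda>x. x + t) ` E" "A \<noteq> {}"
    and cl: "\<forall>a\<in>A. \<forall>b\<in>(\<lambda>x. x + t) ` E. norm (a - b) \<le> c \<longrightarrow> b \<in> A"
  let ?B = "{x \<in> E. x + t \<in> A}"
  have "?B = E"
  proof (rule step_connectedD[OF assms])
    show "?B \<noteq> {}" using A by blast
    fix a b assume "a \<in> ?B" "b \<in> E" "norm (a - b) \<le> c"
    then show "b \<in> ?B" using cl[rule_format, of "a + t" "b + t"] by auto
  qed auto
  then show "A = (\<lambda>x. x + t) ` E" using A by blast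
qed

text \<open>A walk from \<open>0\<close> to \<open>x\<close> with steps of length at most
  \<open>c\<close> cannot jump over an annulus of width \<open>c\<close>. So each annulus up to the
  modulus of \<open>x\<close> contains a point of \<open>E\<close>, and points in different annuli
  differ.\<close>

lemma step_connected_card:
  assumes E: "step_connected c E" and "finite E" "0 \<in> E" "x \<in> E" and c: "c > 0"
  shows "norm x \<le> c * card E"
proof -
  define M where "M = nat \<lceil>norm x / c\<rceil>"
  have "\<exists>b\<in>E. real j * c < norm b \<and> norm b \<le> real (Suc j) * c" if "j < M" for j
  proof -
    have "real j < norm x / c" using that unfolding M_def by linarith
    then have j: "real j * c < norm x" using c by (simp add: field_simps)
    \<comment> \<open>This ball contains \<open>0\<close> but not \<open>x\<close>, so some step
      leaves it; the landing point lies in the next annulus.\<close>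
    let ?A = "{e \<in> E. norm e \<le> real j * c}"
    have "?A \<noteq> E" using \<open>x \<in> E\<close> j by force
    moreover have "?A \<noteq> {}" using \<open>0 \<in> E\<close> c by auto
    ultimately obtain a b where ab: "a \<in> ?A" "b \<in> E" "norm (a - b) \<le> c" "b \<notin> ?A"
      using step_connectedD[OF E, of ?A] by blast
    have "norm b \<le> norm a + norm (a - b)"
      using norm_triangle_sub[of b a] by (simp add: norm_minus_commute)
    with ab show ?thesis by (intro bexI[of _ b]) (auto simp: algebra_simps)
  qed
  then obtain b where b: "\<And>j. j < M \<Longrightarrow> b j \<in> E \<and> real j * c < norm (b j) \<and> norm (b j) \<le> real (Suc j) * c"
    by metis
  have "inj_on b {..<M}"
  proof (rule linorder_inj_onI)
    fix i j assume ij: "i < j" "i \<in> {..<M}" "j \<in> {..<M}"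
    have "real (Suc i) * c \<le> real j * c" using ij c by (intro mult_right_mono) auto
    then have "norm (b i) < norm (b j)" using b[of i] b[of j] ij by auto
    then show "b i \<noteq> b j" by auto
  qed auto
  then have "M \<le> card E" using card_inj_on_le[of b "{..<M}" E] b \<open>finite E\<close> by auto
  moreover have "norm x / c \<le> real M" unfolding M_def by linarith
  ultimately have "norm x / c \<le> real (card E)" by linarith
  then show ?thesis using c by (simp add: field_simps)
qed

section \<open>Polynomials with coefficients -1, 0, 1 and the lower bound for the number of
  sums\<close>

definition unit_poly :: "int poly \<Rightarrow> bool" where
  "unit_poly p \<longleftrightarrow> p \<noteq> 0 \<and> (\<forall>i. coeff p i \<in> {-1, 0, 1})"

lemma unit_poly_lead_coeff:
  assumes "unit_poly p"
  shows "lead_coeff p * lead_coeff p = 1"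
proof -
  have "lead_coeff p \<in> {-1, 0, 1}" "lead_coeff p \<noteq> 0"
    using assms by (auto simp: unit_poly_def)
  then show ?thesis by auto
qed

text \<open>Multiplying by the leading coefficient, which is 1 or -1, makes the polynomial monic;
  the negative terms then move to the other side.\<close>

lemma unit_poly_split:
  assumes "unit_poly p" "poly (map_poly of_int p) (w :: 'a::real_normed_field) = 0"
  obtains N S T where "S \<subseteq> {..<N}" "T \<subseteq> {..<N}" "w ^ N + (\<Sum>k\<in>S. w ^ k) = (\<Sum>k\<in>T. w ^ k)"
proof -
  let ?c = "\<lambda>k. lead_coeff p * coeff p k"
  define N where "N = degree p"
  define S where "S = {k\<in>{..<N}. ?c k = 1}"
  define T where "T = {k\<in>{..<N}. ?c k = -1}"
  have c: "?c k \<in> {-1, 0, 1}" for k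
  proof -
    have "lead_coeff p \<in> {-1, 0, 1}" "coeff p k \<in> {-1, 0, 1}"
      using assms(1) unfolding unit_poly_def by blast+
    then show ?thesis by auto
  qed
  have lc: "lead_coeff p * lead_coeff p = 1" by (rule unit_poly_lead_coeff[OF assms(1)])
  have "0 = of_int (lead_coeff p) * poly (map_poly of_int p) w" using assms by simp
  also have "\<dots> = (\<Sum>k\<le>N. of_int (?c k) * w ^ k)"
    unfolding poly_altdef
    by (simp add: degree_map_poly coeff_map_poly sum_distrib_left N_def mult.assoc)
  also have "\<dots> = w ^ N + (\<Sum>k<N. of_int (?c k) * w ^ k)"
    using lc by (simp add: N_def lessThan_Suc_atMost[symmetric] del: of_int_mult)
  also have "(\<Sum>k<N. of_int (?c k) * w ^ k)
      = (\<Sum>k<N. (if ?c k = 1 then w ^ k else 0) - (if ?c k = -1 then w ^ k else 0))"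
  proof (rule sum.cong[OF refl])
    fix k show "of_int (?c k) * w ^ k = (if ?c k = 1 then w ^ k else 0) - (if ?c k = -1 then w ^ k else 0)"
      using c[of k] by (auto simp del: of_int_mult)
  qed
  also have "\<dots> = (\<Sum>k\<in>S. w ^ k) - (\<Sum>k\<in>T. w ^ k)"
    unfolding sum_subtractf S_def T_def by (simp add: sum.inter_filter del: mem_Collect_eq lessThan_iff)
  finally have "w ^ N + (\<Sum>k\<in>S. w ^ k) = (\<Sum>k\<in>T. w ^ k)" by (simp add: algebra_simps)
  then show thesis using that[of S N T] by (auto simp: S_def T_def)
qed

text \<open>The relation from \<open>unit_poly_split\<close>, multiplied by a power of
  \<open>w\<close>, gives a common point of \<open>power_sums n w\<close> and its translate by
  \<open>w ^ Suc n\<close> once \<open>n \<ge> N\<close>. So all these sets are connected with one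
  fixed step length, and \<open>step_connected_card\<close> applies to the point
  \<open>w ^ n\<close>.\<close>

lemma card_power_sums_ge:
  assumes "unit_poly p" "poly (map_poly of_int p) (w :: 'a::real_normed_field) = 0"
  obtains c :: real where "c > 0" "\<And>n. norm w ^ n \<le> c * card (power_sums n w)"
proof -
  from unit_poly_split[OF assms] obtain N S T where
    ST: "S \<subseteq> {..<N}" "T \<subseteq> {..<N}" "w ^ N + (\<Sum>k\<in>S. w ^ k) = (\<Sum>k\<in>T. w ^ k)" by metis
  define B where "B = (\<Sum>k\<le>N. norm w ^ k)"
  have "B \<ge> 1"
    unfolding B_def using member_le_sum[of 0 "{..N}" "\<lambda>k. norm w ^ k"] by simp
  have bd: "norm e \<le> B" if "e \<in> power_sums N w" for e
  proof -
    from that obtain U where U: "U \<subseteq> {..N}" "e = (\<Sum>k\<in>U. w ^ k)" by (auto simp: power_sums_def)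
    have "norm e \<le> (\<Sum>k\<in>U. norm w ^ k)" unfolding U by (rule order_trans[OF norm_sum]) (simp add: norm_power)
    also have "\<dots> \<le> B" unfolding B_def using U by (intro sum_mono2) auto
    finally show ?thesis .
  qed
  have conn: "step_connected (2 * B) (power_sums n w)" if "n \<le> N" for n
    unfolding step_connected_def
  proof (intro allI impI, elim conjE)
    have sub: "power_sums n w \<subseteq> power_sums N w" using that unfolding power_sums_def by (intro image_mono) auto
    fix A assume A: "A \<subseteq> power_sums n w" "A \<noteq> {}"
      "\<forall>a\<in>A. \<forall>b\<in>power_sums n w. norm (a - b) \<le> 2 * B \<longrightarrow> b \<in> A"
    have "norm (a - b) \<le> 2 * B" if "a \<in> power_sums n w" "b \<in> power_sums n w" for a b
      using norm_triangle_ineq4[of a b] bd[of a] bd[of b] that sub by force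
    then show "A = power_sums n w" using A by blast
  qed
  have conn': "step_connected (2 * B) (power_sums (N + j) w)" for j
  proof (induction j)
    case 0
    show ?case using conn[of N] by simp
  next
    case (Suc j)
    define n where "n = N + j"
    have shift: "(\<Sum>k\<in>(\<lambda>k. k + Suc j) ` U. w ^ k) = (\<Sum>k\<in>U. w ^ k) * w ^ Suc j" for U
      by (subst sum.reindex) (auto simp: inj_on_def sum_distrib_left power_add mult_ac)
    \<comment> \<open>Indices in \<open>S\<close> and \<open>T\<close> are strictly below
      \<open>N\<close>, so the shift by \<open>Suc j\<close> keeps them at most \<open>n\<close>,
      while \<open>w ^ N\<close> becomes \<open>w ^ Suc n\<close>.\<close>
    have "(\<lambda>k. k + Suc j) ` S \<subseteq> {..n}" "(\<lambda>k. k + Suc j) ` T \<subseteq> {..n}"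
      using ST by (auto simp: n_def)
    then have "(\<Sum>k\<in>S. w ^ k) * w ^ Suc j \<in> power_sums n w"
      and T: "(\<Sum>k\<in>T. w ^ k) * w ^ Suc j \<in> power_sums n w"
      unfolding shift[symmetric] by (auto intro: power_sumsI)
    moreover have "(\<Sum>k\<in>S. w ^ k) * w ^ Suc j + w ^ Suc n = (\<Sum>k\<in>T. w ^ k) * w ^ Suc j"
      unfolding ST(3)[symmetric] n_def by (simp add: algebra_simps power_add)
    ultimately have "power_sums n w \<inter> (\<lambda>x. x + w ^ Suc n) ` power_sums n w \<noteq> {}"
      by (metis (no_types, lifting) IntI empty_iff image_eqI)
    then have "step_connected (2 * B) (power_sums (Suc n) w)"
      unfolding power_sums_Suc
      using Suc by (intro step_connected_Un step_connected_translate) (auto simp: n_def)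
    then show ?case by (simp add: n_def)
  qed
  have all: "step_connected (2 * B) (power_sums n w)" for n
    using conn[of n] conn'[of "n - N"] by (cases "n \<le> N") auto
  have "norm w ^ n \<le> 2 * B * card (power_sums n w)" for n
  proof -
    have "w ^ n \<in> power_sums n w" "0 \<in> power_sums n w"
      using power_sumsI[of "{n}" n w] power_sumsI[of "{}" n w] by auto
    from step_connected_card[OF all _ this(2) this(1)] show ?thesis using \<open>B \<ge> 1\<close> by (simp add: norm_power)
  qed
  then show thesis using that[of "2 * B"] \<open>B \<ge> 1\<close> by auto
qed

subsection \<open>Minimal polynomials and conjugates\<close>

abbreviation rat_eval :: "rat poly \<Rightarrow> complex \<Rightarrow> complex" where
  "rat_eval r z \<equiv> poly (map_poly of_rat r) z"

lemma map_poly_of_rat_mult: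
  "map_poly of_rat (p * r) = (map_poly of_rat p * map_poly of_rat r :: complex poly)"
  by (rule poly_eqI) (simp add: coeff_map_poly coeff_mult of_rat_mult of_rat_sum)

lemma rat_eval_mult: "rat_eval (p * r) z = rat_eval p z * rat_eval r z"
  by (simp add: map_poly_of_rat_mult)

lemma rat_eval_add: "rat_eval (p + r) z = rat_eval p z + rat_eval r z"
proof -
  have "map_poly of_rat (p + r) = (map_poly of_rat p + map_poly of_rat r :: complex poly)"
    by (rule poly_eqI) (simp add: coeff_map_poly of_rat_add)
  then show ?thesis by simp
qed

lemma rat_eval_pCons: "rat_eval (pCons a p) z = of_rat a + z * rat_eval p z"
  by (cases "a = 0 \<and> p = 0") (auto simp: map_poly_pCons)

lemma rat_eval_monom: "rat_eval (monom c n) z = of_rat c * z ^ n"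
  by (simp add: map_poly_monom poly_monom)

lemma rat_eval_sum: "rat_eval (\<Sum>i\<in>A. p i) z = (\<Sum>i\<in>A. rat_eval (p i) z)"
  by (induction A rule: infinite_finite_induct) (auto simp: rat_eval_add)

lemma rat_eval_pcompose: "rat_eval (pcompose r s) z = rat_eval r (rat_eval s z)"
  by (induction r) (auto simp: pcompose_pCons rat_eval_pCons rat_eval_add rat_eval_mult)

lemma is_min_poly_dvd:
  assumes f: "is_min_poly z f" and r: "rat_eval r z = 0"
  shows "f dvd r"
proof (rule ccontr)
  assume "\<not> f dvd r"
  then have nz: "r mod f \<noteq> 0" by (simp add: dvd_eq_mod_eq_0)
  have f0: "f \<noteq> 0" "rat_eval f z = 0" using f by (auto simp: is_min_poly_def)
  have "rat_eval (r div f * f + r mod f) z = 0" using r by simp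
  then have "rat_eval (r mod f) z = 0" unfolding rat_eval_add rat_eval_mult using f0 by simp
  then have "degree f \<le> degree (r mod f)" using f nz by (auto simp: is_min_poly_def)
  then show False using degree_mod_less[of f r] f0 nz by auto
qed

lemma is_min_poly_conjugate:
  assumes "is_min_poly z f" "rat_eval f w = 0" "rat_eval r z = 0"
  shows "rat_eval r w = 0"
  using is_min_poly_dvd[OF assms(1,3)] assms(2) by (auto simp: rat_eval_mult elim!: dvdE)

lemma is_min_poly_root_algebraic:
  assumes "is_min_poly z f" "rat_eval f w = 0"
  shows "algebraic w"
proof -
  have "map_poly of_rat f \<noteq> (0 :: complex poly)"
    using assms(1) by (auto simp: is_min_poly_def map_poly_eq_0_iff)
  moreover have "\<forall>i. coeff (map_poly of_rat f) i \<in> (\<rat> :: complex set)"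
    by (auto simp: coeff_map_poly)
  ultimately show ?thesis using assms(2) unfolding algebraic_altdef by blast
qed

text \<open>The minimal polynomial \<open>g\<close> of \<open>w\<close> divides \<open>f\<close>.
  The cofactor cannot vanish at \<open>z\<close>, since minimality of \<open>f\<close> would make
  \<open>g\<close> constant; so \<open>g\<close> vanishes at \<open>z\<close>.\<close>

lemma is_min_poly_conjugate_sym:
  assumes f: "is_min_poly z f" and w: "rat_eval f w = 0" and r: "rat_eval r w = 0"
  shows "rat_eval r z = 0"
proof -
  obtain g where g: "is_min_poly w g"
    using ex1_is_min_poly[OF is_min_poly_root_algebraic[OF f w]] by blast
  obtain h where h: "f = g * h" using is_min_poly_dvd[OF g w] by (elim dvdE)
  have nz: "f \<noteq> 0" using f by (auto simp: is_min_poly_def)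
  then have gh: "g \<noteq> 0" "h \<noteq> 0" using h by auto
  have "rat_eval h z \<noteq> 0"
  proof
    assume "rat_eval h z = 0"
    then have "degree f \<le> degree h" using f gh by (auto simp: is_min_poly_def)
    then have "degree g = 0" using h gh by (simp add: degree_mult_eq)
    then obtain c where "g = [:c:]" by (metis degree_eq_zeroE)
    then show False using g by (auto simp: is_min_poly_def rat_eval_pCons)
  qed
  then have "rat_eval g z = 0"
    using f h by (auto simp: is_min_poly_def rat_eval_mult)
  with is_min_poly_dvd[OF g r] show ?thesis by (auto simp: rat_eval_mult elim!: dvdE)
qed

text \<open>The roots are simple: a common root of \<open>f\<close> and its derivative would, by
  symmetry of conjugacy, make the derivative vanish at \<open>z\<close>, against the minimal degree
  of \<open>f\<close>.\<close>

lemma is_min_poly_roots: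
  assumes f: "is_min_poly z f"
  shows "(\<Prod>a | rat_eval f a = 0. [:-a, 1:]) = map_poly of_rat f"
proof -
  have deg: "degree f > 0"
  proof (rule ccontr)
    assume "\<not> degree f > 0"
    then obtain c where "f = [:c:]" by (metis degree_eq_zeroE neq0_conv)
    then show False using f by (auto simp: is_min_poly_def rat_eval_pCons)
  qed
  have pd: "pderiv (map_poly of_rat f) = (map_poly of_rat (pderiv f) :: complex poly)"
    by (rule poly_eqI) (simp add: coeff_map_poly coeff_pderiv of_rat_mult flip: of_nat_Suc)
  have "rsquarefree (map_poly of_rat f :: complex poly)"
    unfolding rsquarefree_roots pd
  proof (intro allI notI, elim conjE)
    fix a assume a: "rat_eval f a = 0" "rat_eval (pderiv f) a = 0"
    then have "rat_eval (pderiv f) z = 0" using is_min_poly_conjugate_sym[OF f] by blast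
    moreover have "pderiv f \<noteq> 0" using deg by (simp add: pderiv_eq_0_iff)
    ultimately have "degree f \<le> degree (pderiv f)" using f by (auto simp: is_min_poly_def)
    then show False using deg by (simp add: degree_pderiv)
  qed
  from complex_poly_decompose_rsquarefree[OF this] show ?thesis
    using f by (simp add: is_min_poly_def degree_map_poly coeff_map_poly)
qed

subsection \<open>Power sums and elementary symmetric sums\<close>

text \<open>The reversal of the monic polynomial with roots \<open>g x\<close>, with multiplicity
  over the index set. Its constant term is always 1, and its logarithmic derivative generates the
  power sums.\<close>

definition recip_poly :: "'b set \<Rightarrow> ('b \<Rightarrow> complex) \<Rightarrow> complex poly" where
  "recip_poly A g = (\<Prod>x\<in>A. [:1, - g x:])"

text \<open>This is the logarithmic derivative, multiplied out: the factor
  \<open>1 - g x * X\<close> contributes \<open>- g x / (1 - g x * X)\<close>, a geometric series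
  with coefficients \<open>- g x ^ Suc k\<close>.\<close>

lemma newton_fps:
  assumes "finite A"
  shows "fps_deriv (fps_of_poly (recip_poly A g)) =
    - (fps_of_poly (recip_poly A g) * Abs_fps (\<lambda>k. \<Sum>x\<in>A. g x ^ Suc k))"
  using assms
proof (induction A)
  case empty
  then show ?case by (simp add: recip_poly_def fps_eq_iff fps_mult_nth)
next
  case (insert a A)
  let ?E = "fps_of_poly (recip_poly A g)" and ?l = "1 - fps_const (g a) * fps_X"
  let ?G = "Abs_fps (\<lambda>k. \<Sum>x\<in>A. g x ^ Suc k)"
  have E: "fps_of_poly (recip_poly (insert a A) g) = ?l * ?E"
    using insert by (simp add: recip_poly_def fps_of_poly_mult fps_of_poly_pCons fps_const_neg[symmetric] del: fps_const_neg)
  have G: "Abs_fps (\<lambda>k. \<Sum>x\<in>insert a A. g x ^ Suc k) = Abs_fps (\<lambda>k. g a ^ Suc k) + ?G"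
    using insert by (simp add: fps_eq_iff)
  have geo: "?l * Abs_fps (\<lambda>k. g a ^ Suc k) = fps_const (g a)"
  proof (rule fps_ext)
    fix n show "fps_nth (?l * Abs_fps (\<lambda>k. g a ^ Suc k)) n = fps_nth (fps_const (g a)) n"
      by (cases n) (auto simp: left_diff_distrib mult.assoc fps_X_mult_nth)
  qed
  have "fps_deriv (?l * ?E) = - (fps_const (g a) * ?E) + ?l * (- (?E * ?G))"
    by (simp add: insert.IH algebra_simps)
  moreover have "- (c * E) + l * (- (E * G)) = - ((l * E) * (H + G))" if "l * H = c"
    for c l E G H :: "complex fps"
    unfolding that[symmetric] by (simp add: algebra_simps)
  note this[OF geo, of ?E ?G]
  ultimately show ?case unfolding E G by (rule trans)
qed

lemma newton_identity:
  assumes "finite A"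
  shows "of_nat (Suc n) * coeff (recip_poly A g) (Suc n) =
    - (\<Sum>i\<le>n. coeff (recip_poly A g) i * (\<Sum>x\<in>A. g x ^ Suc (n - i)))"
  using arg_cong[OF newton_fps[OF assms, of g], of "\<lambda>F. fps_nth F n"]
  by (simp add: fps_mult_nth atLeast0AtMost)

lemma coeff_recip_poly_0: "coeff (recip_poly A g) 0 = 1"
  unfolding recip_poly_def by (induction A rule: infinite_finite_induct) (auto simp: coeff_mult_0)

text \<open>Newton's identity is solved for the highest power sum, which is multiplied by the
  constant term 1.\<close>

lemma Rats_power_sum:
  assumes A: "finite A" and c: "\<And>i. coeff (recip_poly A g) i \<in> \<rat>"
  shows "(\<Sum>x\<in>A. g x ^ k) \<in> \<rat>"
proof (induction k rule: less_induct)
  case (less k)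
  show ?case
  proof (cases k)
    case 0
    then show ?thesis by simp
  next
    case (Suc n)
    let ?c = "\<lambda>i. coeff (recip_poly A g) i"
    let ?p = "\<lambda>k. \<Sum>x\<in>A. g x ^ k"
    have "(\<Sum>i\<le>n. ?c i * ?p (Suc (n - i))) = ?p (Suc n) + (\<Sum>i\<in>{1..n}. ?c i * ?p (Suc (n - i)))"
      by (subst sum.remove[of _ 0]) (auto simp: coeff_recip_poly_0 intro!: sum.cong)
    then have "?p k = - (of_nat (Suc n) * ?c (Suc n)) - (\<Sum>i\<in>{1..n}. ?c i * ?p (Suc (n - i)))"
      using newton_identity[OF A, of n g] unfolding Suc by (simp only: minus_minus add_diff_cancel_right')
    also have "\<dots> \<in> \<rat>"
    proof -
      have "?p (Suc (n - i)) \<in> \<rat>" if "i \<in> {1..n}" for i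
        using that by (intro less) (auto simp: Suc)
      then have "(\<Sum>i\<in>{1..n}. ?c i * ?p (Suc (n - i))) \<in> \<rat>"
        by (intro Rats_sum[of "{1..n}"] Rats_mult[OF c])
      then show ?thesis
        by (intro Rats_diff Rats_minus_iff[THEN iffD2] Rats_mult c Rats_of_nat)
    qed
    finally show ?thesis .
  qed
qed

text \<open>The converse: Newton's identity is solved for the highest coefficient, after division by
  \<open>Suc n\<close>.\<close>

lemma Rats_coeff_recip_poly:
  assumes A: "finite A" and p: "\<And>k. (\<Sum>x\<in>A. g x ^ k) \<in> \<rat>"
  shows "coeff (recip_poly A g) k \<in> \<rat>"
proof (induction k rule: less_induct)
  case (less k)
  show ?case
  proof (cases k)
    case 0
    then show ?thesis by (simp add: coeff_recip_poly_0)
  next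
    case (Suc n)
    define X where "X = - (\<Sum>i\<le>n. coeff (recip_poly A g) i * (\<Sum>x\<in>A. g x ^ Suc (n - i)))"
    have "X \<in> \<rat>"
      unfolding X_def Rats_minus_iff
    proof (rule Rats_sum)
      fix i assume "i \<in> {..n}"
      then have "coeff (recip_poly A g) i \<in> \<rat>" using less[of i] Suc by simp
      then show "coeff (recip_poly A g) i * (\<Sum>x\<in>A. g x ^ Suc (n - i)) \<in> \<rat>"
        by (rule Rats_mult[OF _ p])
    qed
    moreover have "of_nat (Suc n) * coeff (recip_poly A g) k = X"
      unfolding X_def Suc by (rule newton_identity[OF A])
    then have "coeff (recip_poly A g) k = X / of_nat (Suc n)"
      by (simp add: nonzero_eq_divide_eq mult.commute del: of_nat_Suc)
    ultimately show ?thesis by (simp del: of_nat_Suc)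
  qed
qed

lemma coeff_recip_poly:
  assumes "finite A"
  shows "coeff (recip_poly A g) m = (-1) ^ m * (\<Sum>I | I \<subseteq> A \<and> card I = m. \<Prod>x\<in>I. g x)"
proof -
  have "recip_poly A g = (\<Prod>x\<in>A. monom (- g x) 1 + 1)"
    unfolding recip_poly_def by (intro prod.cong) (auto simp: monom_Suc monom_0 one_pCons)
  also have "\<dots> = (\<Sum>I\<in>Pow A. \<Prod>x\<in>I. monom (- g x) 1)"
    using assms by (subst prod_add) auto
  also have "\<dots> = (\<Sum>I\<in>Pow A. monom (\<Prod>x\<in>I. - g x) (card I))"
  proof (rule sum.cong[OF refl])
    fix I assume "I \<in> Pow A"
    then have "finite I" using assms finite_subset by auto
    then show "(\<Prod>x\<in>I. monom (- g x) 1) = monom (\<Prod>x\<in>I. - g x) (card I)"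
      by (induction I) (auto simp: mult_monom)
  qed
  finally have "coeff (recip_poly A g) m = (\<Sum>I\<in>Pow A. if card I = m then \<Prod>x\<in>I. - g x else 0)"
    by (simp add: coeff_sum)
  also have "\<dots> = (\<Sum>I | I \<subseteq> A \<and> card I = m. \<Prod>x\<in>I. - g x)"
    using assms by (subst sum.inter_filter[symmetric]) auto
  also have "\<dots> = (-1) ^ m * (\<Sum>I | I \<subseteq> A \<and> card I = m. \<Prod>x\<in>I. g x)"
    by (simp add: prod_uminus sum_distrib_left)
  finally show ?thesis .
qed

lemma Rats_root_power_sum:
  assumes "finite A" "\<And>i. coeff (\<Prod>a\<in>A. [:- a, 1:]) i \<in> (\<rat> :: complex set)"
  shows "(\<Sum>a\<in>A. a ^ k) \<in> \<rat>"
proof -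
  have "recip_poly A (\<lambda>x. x) = reflect_poly (\<Prod>a\<in>A. [:- a, 1:])"
    unfolding recip_poly_def reflect_poly_prod
    by (intro prod.cong) (auto simp: reflect_poly_def)
  then have "coeff (recip_poly A (\<lambda>x. x)) i \<in> \<rat>" for i
    by (simp add: coeff_reflect_poly assms(2))
  then show ?thesis by (rule Rats_power_sum[OF assms(1)])
qed

text \<open>Up to sign this is a coefficient of \<open>recip_poly\<close> for the
  \<open>n\<close>-th powers of the elements of \<open>A\<close>, whose power sums are again power
  sums of \<open>A\<close>. It provides the power sums of the family of all products of
  \<open>m\<close> roots.\<close>

lemma Rats_esym_power:
  assumes "finite A" "\<And>i. coeff (\<Prod>a\<in>A. [:- a, 1:]) i \<in> (\<rat> :: complex set)"
  shows "(\<Sum>I | I \<subseteq> A \<and> card I = m. (\<Prod>I) ^ n) \<in> \<rat>"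
proof -
  have "(\<Sum>x\<in>A. (x ^ n) ^ k) \<in> \<rat>" for k
    using Rats_root_power_sum[OF assms, of "n * k"] by (simp add: power_mult)
  then have "coeff (recip_poly A (\<lambda>x. x ^ n)) m \<in> \<rat>" by (rule Rats_coeff_recip_poly[OF assms(1)])
  then have "(-1) ^ m * coeff (recip_poly A (\<lambda>x. x ^ n)) m \<in> \<rat>" by (intro Rats_mult) auto
  then show ?thesis
    unfolding coeff_recip_poly[OF assms(1)] 
    by (simp add: prod_power_distrib)
qed

subsection \<open>Conjugates of maximal modulus\<close>

text \<open>Extend \<open>1\<close> to a basis of the complex numbers over the rationals and take
  the coordinate at \<open>1\<close>.\<close>

lemma rat_functional:
  obtains \<phi> :: "complex \<Rightarrow> rat"
  where "\<phi> 1 = 1" "\<And>x y. \<phi> (x + y) = \<phi> x + \<phi> y" "\<And>r x. \<phi> (of_rat r * x) = r * \<phi> x"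
proof -
  interpret vector_space "\<lambda>(r::rat) (z::complex). of_rat r * z"
    by standard (simp_all add: of_rat_add of_rat_mult algebra_simps)
  define B where "B = extend_basis {1 :: complex}"
  have ind: "independent {1 :: complex}" by simp
  then have B: "independent B" "span B = UNIV" "1 \<in> B"
    using independent_extend_basis[OF ind] span_extend_basis[OF ind] extend_basis_superset[OF ind]
    by (simp_all add: B_def)
  show thesis
  proof (rule that[of "\<lambda>z. representation B z 1"])
    show "representation B 1 1 = 1" using B by (simp add: representation_basis)
    show "representation B (x + y) 1 = representation B x 1 + representation B y 1" for x y
      using B by (simp add: representation_add)
    show "representation B (of_rat r * x) 1 = r * representation B x 1" for r x
      using B by (simp add: representation_scale)
  qed
qed

text \<open>
  The monic polynomial with roots \<open>l ` J\<close> is characterised by linear equations whose coefficients are the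
  rational power sums; applying a \<open>\<rat>\<close>-linear retraction \<open>\<complex> \<rightarrow> \<rat>\<close> to its coefficients gives another
  solution, so it is rational.
\<close>

lemma rational_poly_of_power_sums:
  fixes l :: "'b \<Rightarrow> complex"
  assumes fin: "finite J" and rat: "\<And>n. (\<Sum>i\<in>J. l i ^ n) \<in> \<rat>"
  obtains R :: "rat poly" where "\<And>x. rat_eval R x = 0 \<longleftrightarrow> x \<in> l ` J"
proof -
  obtain \<phi> :: "complex \<Rightarrow> rat"
    where \<phi>: "\<phi> 1 = 1" "\<And>x y. \<phi> (x + y) = \<phi> x + \<phi> y" "\<And>r x. \<phi> (of_rat r * x) = r * \<phi> x"
    by (rule rat_functional) blast
  have \<phi>0: "\<phi> 0 = 0" using \<phi>(3)[of 0 0] by simp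
  have \<phi>_sum: "\<phi> (\<Sum>i\<in>A. h i) = (\<Sum>i\<in>A. \<phi> (h i))" for A and h :: "nat \<Rightarrow> complex"
    by (induction A rule: infinite_finite_induct) (auto simp: \<phi>0 \<phi>(2))
  define L where "L = l ` J"
  have finL: "finite L" using fin by (simp add: L_def)
  define P where "P = (\<Prod>a\<in>L. [:- a, 1:])"
  define R where "R = map_poly \<phi> P"
  have P0: "poly P x = 0 \<longleftrightarrow> x \<in> L" for x
    using finL by (auto simp: P_def poly_prod)
  have lcP: "lead_coeff P = 1" unfolding P_def by (simp add: lead_coeff_prod)
  have degP: "degree P = card L" unfolding P_def by (subst degree_prod_eq_sum_degree) auto
  have "\<exists>r. (\<Sum>i\<in>J. l i ^ n) = of_rat r" for n using rat[of n] by (auto elim: Rats_cases)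
  then obtain u where u: "\<And>n. (\<Sum>i\<in>J. l i ^ n) = of_rat (u n)" by metis
  have degR: "degree R \<le> degree P" 
    unfolding R_def by (rule degree_le) (simp add: coeff_map_poly \<phi>0 coeff_eq_0)
  have ann: "(\<Sum>i\<in>J. l i ^ n * rat_eval R (l i)) = 0" for n
  proof -
    have "0 = (\<Sum>i\<in>J. l i ^ n * poly P (l i))" 
      using P0 by (intro sum.neutral[symmetric]) (simp add: L_def)
    also have "\<dots> = (\<Sum>i\<in>J. \<Sum>k\<le>degree P. coeff P k * l i ^ (n + k))"
      by (simp add: poly_altdef sum_distrib_left power_add mult_ac)
    also have "\<dots> = (\<Sum>k\<le>degree P. of_rat (u (n + k)) * coeff P k)"
      by (subst sum.swap) (simp add: u[symmetric] sum_distrib_left mult.commute)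
    finally have "\<phi> 0 = \<phi> (\<Sum>k\<le>degree P. of_rat (u (n + k)) * coeff P k)"
      by (rule arg_cong)
    also have "\<dots> = (\<Sum>k\<le>degree P. u (n + k) * \<phi> (coeff P k))"
      by (simp only: \<phi>_sum \<phi>(3))
    finally have "0 = (\<Sum>k\<le>degree P. u (n + k) * coeff R k)"
      by (simp add: \<phi>0 R_def coeff_map_poly)
    then have "0 = (of_rat (\<Sum>k\<le>degree P. u (n + k) * coeff R k) :: complex)" by simp
    also have "\<dots> = (\<Sum>k\<le>degree P. \<Sum>i\<in>J. of_rat (coeff R k) * l i ^ (n + k))"
      by (simp add: of_rat_sum of_rat_mult u[symmetric] sum_distrib_left mult.commute)
    also have "\<dots> = (\<Sum>i\<in>J. l i ^ n * (\<Sum>k\<le>degree P. of_rat (coeff R k) * l i ^ k))"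
      by (subst sum.swap) (simp add: sum_distrib_left power_add mult_ac)
    also have "(\<lambda>x. \<Sum>k\<le>degree P. of_rat (coeff R k) * x ^ k) = rat_eval R"
    proof
      fix x show "(\<Sum>k\<le>degree P. of_rat (coeff R k) * x ^ k) = rat_eval R x"
        unfolding poly_altdef coeff_map_poly[of of_rat, OF of_rat_0]
        by (rule sum.mono_neutral_right) (use degR in \<open>auto simp: degree_map_poly coeff_eq_0\<close>)
    qed
    finally show ?thesis ..
  qed
  have ann': "(\<Sum>i\<in>J. poly h (l i) * rat_eval R (l i)) = 0" for h
  proof -
    have "(\<Sum>i\<in>J. poly h (l i) * rat_eval R (l i)) =
        (\<Sum>i\<in>J. \<Sum>k\<le>degree h. coeff h k * (l i ^ k * rat_eval R (l i)))"
      by (simp add: poly_altdef sum_distrib_right mult_ac)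
    also have "\<dots> = (\<Sum>k\<le>degree h. coeff h k * (\<Sum>i\<in>J. l i ^ k * rat_eval R (l i)))"
      by (subst sum.swap) (simp add: sum_distrib_left)
    finally show ?thesis by (simp add: ann)
  qed
  have van: "rat_eval R a = 0" if a: "a \<in> L" for a
  proof -
    \<comment> \<open>The polynomial \<open>h\<close> isolates the terms with
      \<open>l i = a\<close>; these are equal to each other and at least one exists.\<close>
    define h where "h = (\<Prod>b\<in>L - {a}. [:- b, 1:])"
    have h: "poly h x = 0 \<longleftrightarrow> x \<in> L - {a}" for x
      using finL by (auto simp: h_def poly_prod)
    have "0 = (\<Sum>i\<in>J. poly h (l i) * rat_eval R (l i))" using ann' by simp
    also have "\<dots> = (\<Sum>i\<in>{i\<in>J. l i = a}. poly h a * rat_eval R a)"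
      by (rule sum.mono_neutral_cong_right) (use fin h in \<open>auto simp: L_def\<close>)
    also have "\<dots> = of_nat (card {i\<in>J. l i = a}) * (poly h a * rat_eval R a)" by simp
    finally have "card {i\<in>J. l i = a} = 0 \<or> poly h a = 0 \<or> rat_eval R a = 0" by simp
    moreover have "card {i\<in>J. l i = a} \<noteq> 0" using a fin by (auto simp: L_def)
    ultimately show ?thesis using h by auto
  qed
  have "map_poly of_rat R = P"
  proof (rule ccontr)
    assume ne: "map_poly of_rat R \<noteq> P"
    \<comment> \<open>The leading terms cancel because \<open>\<phi> 1 = 1\<close>, so
      \<open>?D\<close> has degree below \<open>card L\<close> but vanishes on all of
      \<open>L\<close>.\<close>
    let ?D = "map_poly of_rat R - P"
    have nz: "?D \<noteq> 0" using ne by simp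
    have "L \<subseteq> {x. poly ?D x = 0}" using van P0 by auto
    then have "card L \<le> card {x. poly ?D x = 0}"
      by (rule card_mono[OF poly_roots_finite[OF nz]])
    also have "\<dots> \<le> degree ?D" by (rule card_poly_roots_bound[OF nz])
    finally have "card L \<le> degree ?D" .
    moreover have "degree ?D \<le> card L"
      using degR degP by (intro degree_diff_le) (auto simp: degree_map_poly)
    moreover have "coeff ?D (card L) = 0"
      using lcP degP \<phi>(1) by (simp add: R_def coeff_map_poly \<phi>0)
    ultimately have "lead_coeff ?D = 0" by (metis le_antisym)
    then show False using nz by (simp only: leading_coeff_0_iff)
  qed
  then show thesis using that[of R] P0 by (simp add: L_def)
qed

text \<open>Let \<open>R\<close> have the products of \<open>m\<close> conjugates as roots. As the
  product of \<open>S\<close> is \<open>\<plusminus>q ^ m\<close>, the composition of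
  \<open>R\<close> with \<open>\<plusminus>X ^ m\<close> vanishes at \<open>q\<close>, hence at each
  \<open>w\<close> in \<open>S\<close>. So \<open>\<plusminus>w ^ m\<close> is a product of
  \<open>m\<close> conjugates, and by its modulus it can only be the product of
  \<open>S\<close>.\<close>

lemma max_modulus_conjugates:
  assumes f: "is_min_poly (complex_of_real q) f" and q: "q > 0"
    and le: "\<And>a. rat_eval f a = 0 \<Longrightarrow> cmod a \<le> q"
  defines "S \<equiv> {a. rat_eval f a = 0 \<and> cmod a = q}"
  shows "S = {w. w ^ card S = complex_of_real (q ^ card S)}" and "card S > 0"
proof -
  define A where "A = {a. rat_eval f a = 0}"
  have f0: "f \<noteq> 0" "rat_eval f (complex_of_real q) = 0" using f by (auto simp: is_min_poly_def)
  then have "map_poly of_rat f \<noteq> (0 :: complex poly)" by (simp add: map_poly_eq_0_iff)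
  then have finA: "finite A" unfolding A_def by (rule poly_roots_finite)
  have SA: "S \<subseteq> A" by (auto simp: S_def A_def)
  then have finS: "finite S" using finA finite_subset by blast
  have qS: "complex_of_real q \<in> S" using f0 q by (simp add: S_def)
  define m where "m = card S"
  have m: "m > 0" using qS finS by (auto simp: m_def card_gt_0_iff)
  then show "card S > 0" by (simp add: m_def)
  define J where "J = {I. I \<subseteq> A \<and> card I = m}"
  have finJ: "finite J" unfolding J_def using finA by simp
  have "(\<Sum>I\<in>J. (\<Prod>I) ^ n) \<in> \<rat>" for n
    unfolding J_def
    by (rule Rats_esym_power[OF finA])
       (unfold A_def is_min_poly_roots[OF f], simp add: coeff_map_poly)
  then obtain R where R: "\<And>x. rat_eval R x = 0 \<longleftrightarrow> x \<in> Prod ` J"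
    using rational_poly_of_power_sums[OF finJ, of Prod] by blast
  have SJ: "S \<in> J" using SA by (simp add: J_def m_def)
  \<comment> \<open>A different set of \<open>m\<close> conjugates contains one outside
    \<open>S\<close>, of modulus below \<open>q\<close>, which makes the product too small.\<close>
  have uniq: "I = S" if I: "I \<in> J" "cmod (\<Prod>I) = q ^ m" for I
  proof (rule ccontr)
    assume "I \<noteq> S"
    have IA: "I \<subseteq> A" "card I = card S" "finite I"
      using I finA finite_subset by (auto simp: J_def m_def)
    then obtain a where a: "a \<in> I" "a \<notin> S"
      using \<open>I \<noteq> S\<close> finS by (metis card_subset_eq subsetI)
    then have lt: "cmod a < q" using IA le[of a] by (force simp: A_def S_def)
    have "cmod (\<Prod>I) = cmod a * (\<Prod>b\<in>I - {a}. cmod b)"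
      unfolding prod_norm[symmetric] using a IA by (intro prod.remove)
    also have "\<dots> \<le> cmod a * (\<Prod>b\<in>I - {a}. q)"
      using IA le by (intro mult_left_mono prod_mono) (auto simp: A_def)
    also have "\<dots> < q * (\<Prod>b\<in>I - {a}. q)"
      using lt q by (intro mult_strict_right_mono prod_pos) auto
    also have "\<dots> = q ^ card I"
      using card_Suc_Diff1[OF IA(3) a(1)] by (simp flip: power_Suc)
    finally show False using I by (simp add: J_def)
  qed
  \<comment> \<open>Closure under complex conjugation makes the product of \<open>S\<close> real, so
    only its sign is open.\<close>
  have cnjS: "cnj ` S = S"
  proof -
    have "cnj a \<in> S" if "a \<in> S" for a
    proof -
      have "complex_of_rat c \<in> \<real>" for c by (cases c) (simp add: of_rat_rat Reals_divide)
      then have "rat_eval f (cnj a) = cnj (rat_eval f a)"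
        by (intro poly_cnj_real[symmetric]) (simp add: coeff_map_poly)
      then show ?thesis using that by (auto simp: S_def)
    qed
    then show ?thesis by (metis (no_types, lifting) complex_cnj_cnj image_eqI image_subsetI subsetI subset_antisym)
  qed
  have "cnj (\<Prod>S) = \<Prod>(cnj ` S)"
    by (subst prod.reindex) (auto simp: inj_on_def cnj_prod)
  then have "\<Prod>S \<in> \<real>" unfolding cnjS by (simp add: Reals_cnj_iff)
  then obtain p where p: "\<Prod>S = complex_of_real p" by (auto elim: Reals_cases)
  have "cmod (\<Prod>S) = (\<Prod>a\<in>S. q)" unfolding prod_norm[symmetric] by (rule prod.cong) (auto simp: S_def)
  then have norm_p: "\<bar>p\<bar> = q ^ m" using p by (simp add: m_def)
  \<comment> \<open>The sign is taken in the rationals so that \<open>monom \<epsilon> m\<close> can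
    be composed with \<open>R\<close>.\<close>
  define \<epsilon> :: rat where "\<epsilon> = (if p = q ^ m then 1 else - 1)"
  have \<epsilon>: "\<Prod>S = of_rat \<epsilon> * complex_of_real (q ^ m)"
  proof -
    have "p = q ^ m \<or> p = - (q ^ m)" using norm_p by linarith
    then show ?thesis by (auto simp: p \<epsilon>_def)
  qed
  have "w ^ m = complex_of_real (q ^ m)" if w: "w \<in> S" for w
  proof -
    have "rat_eval (pcompose R (monom \<epsilon> m)) (complex_of_real q) = 0"
      unfolding rat_eval_pcompose rat_eval_monom of_real_power[symmetric] \<epsilon>[symmetric] R
      using SJ by (rule imageI)
    then have "rat_eval (pcompose R (monom \<epsilon> m)) w = 0"
      using is_min_poly_conjugate[OF f] w by (auto simp: S_def)
    then obtain I where I: "I \<in> J" "of_rat \<epsilon> * w ^ m = \<Prod>I"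
      unfolding rat_eval_pcompose rat_eval_monom R by auto
    have "cmod (of_rat \<epsilon> * w ^ m) = q ^ m"
      using w by (simp add: \<epsilon>_def S_def norm_mult norm_power)
    then have "of_rat \<epsilon> * w ^ m = \<Prod>S" using uniq I by metis
    then show ?thesis unfolding \<epsilon> by (auto simp: \<epsilon>_def split: if_splits)
  qed
  then have "S \<subseteq> {w. w ^ m = complex_of_real (q ^ m)}" by blast
  moreover have "card {w. w ^ m = complex_of_real (q ^ m)} = card S"
    using card_nth_roots[of "complex_of_real (q ^ m)" m] m q by (simp add: m_def)
  moreover have "finite {w. w ^ m = complex_of_real (q ^ m)}"
    using m q by (intro finite_nth_roots) auto
  ultimately have "S = {w. w ^ m = complex_of_real (q ^ m)}" by (metis card_subset_eq)
  then show "S = {w. w ^ card S = complex_of_real (q ^ card S)}" by (simp add: m_def)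
qed

section \<open>From a polynomial for \<open>q\<close> to a polynomial for its \<open>m\<close>-th
  power\<close>

lemma sum_nth_roots_power:
  fixes c :: complex
  assumes m: "m > 0" and "\<not> m dvd t"
  shows "(\<Sum>w | w ^ m = c. w ^ t) = 0"
proof -
  define \<zeta> where "\<zeta> = exp (2 * of_real pi * \<i> * of_nat 1 / of_nat m)"
  have \<zeta>_pow: "\<zeta> ^ k = exp (2 * of_real pi * \<i> * of_nat k / of_nat m)" for k
    unfolding \<zeta>_def by (simp add: exp_of_nat_mult[symmetric] mult_ac)
  have \<zeta>m: "\<zeta> ^ m = 1" and \<zeta>t: "\<zeta> ^ t \<noteq> 1"
    unfolding \<zeta>_pow using complex_root_unity_eq_1[of m] assms by auto
  have z0: "\<zeta> \<noteq> 0" by (simp add: \<zeta>_def)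
  \<comment> \<open>Multiplication by \<open>\<zeta>\<close> permutes the \<open>m\<close>-th roots
    of \<open>c\<close> and scales the sum by \<open>\<zeta> ^ t\<close>, which is not 1.\<close>
  have "(\<Sum>w | w ^ m = c. w ^ t) = (\<Sum>w | w ^ m = c. (\<zeta> * w) ^ t)"
    by (rule sum.reindex_bij_witness[of _ "\<lambda>w. \<zeta> * w" "\<lambda>w. w / \<zeta>"])
       (use z0 \<zeta>m in \<open>auto simp: power_mult_distrib power_divide\<close>)
  also have "\<dots> = \<zeta> ^ t * (\<Sum>w | w ^ m = c. w ^ t)"
    by (simp add: power_mult_distrib sum_distrib_left)
  finally show ?thesis using \<zeta>t by simp
qed

text \<open>Summing \<open>w ^ r\<close> times the value of \<open>p\<close> at \<open>w\<close>
  over the \<open>m\<close>-th roots \<open>w\<close> of \<open>c\<close> kills every exponent not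
  divisible by \<open>m\<close>; what survives is \<open>m\<close> times a polynomial in
  \<open>c\<close>.\<close>

lemma unit_poly_root_power:
  assumes p: "unit_poly p" and m: "m > 0" and c: "(c :: complex) \<noteq> 0"
    and root: "\<And>w. w ^ m = c \<Longrightarrow> poly (map_poly of_int p) w = 0"
  obtains p' where "unit_poly p'" "poly (map_poly of_int p') c = 0"
proof -
  obtain k where k: "coeff p k \<noteq> 0" using p by (auto simp: unit_poly_def poly_eq_iff)
  \<comment> \<open>With this shift \<open>m\<close> divides \<open>k + r\<close>, so the nonzero
    coefficient at \<open>k\<close> survives.\<close>
  define r where "r = m - k mod m"
  define e where "e j = (j + r) div m" for j
  define J where "J = {j. j \<le> degree p \<and> m dvd j + r}"
  have finJ: "finite J" by (rule finite_subset[of _ "{..degree p}"]) (auto simp: J_def)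
  have "k + r = m * (k div m + 1)"
    using mod_less_divisor[OF m, of k] mult_div_mod_eq[of m k] unfolding r_def distrib_left by linarith
  then have kJ: "k \<in> J" using k by (auto simp: J_def le_degree)
  have me: "m * e j = j + r" if "j \<in> J" for j using that by (simp add: J_def e_def)
  \<comment> \<open>No two surviving terms merge, so the coefficients of \<open>p'\<close> are
    coefficients of \<open>p\<close> or zero.\<close>
  have inj: "i = j" if "i \<in> J" "j \<in> J" "e i = e j" for i j
    using me[OF that(1)] me[OF that(2)] that(3) by (metis add_right_cancel)
  define p' where "p' = (\<Sum>j\<in>J. monom (coeff p j) (e j))"
  have co: "coeff p' i = (\<Sum>j\<in>J. if e j = i then coeff p j else 0)" for i
    by (simp add: p'_def coeff_sum)
  have co1: "coeff p' (e j) = coeff p j" if j: "j \<in> J" for j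
  proof -
    have "coeff p' (e j) = (\<Sum>i\<in>J. if i = j then coeff p i else 0)"
      unfolding co by (intro sum.cong) (use inj j in auto)
    then show ?thesis using finJ j by simp
  qed
  have co0: "coeff p' i = 0" if "i \<notin> e ` J" for i
    unfolding co by (rule sum.neutral) (use that in auto)
  have "coeff p' i \<in> {-1, 0, 1}" for i
    using co0[of i] co1 p by (cases "i \<in> e ` J") (auto simp: unit_poly_def)
  moreover have "p' \<noteq> 0" using co1[OF kJ] k by auto
  ultimately have "unit_poly p'" by (simp add: unit_poly_def)
  moreover have "poly (map_poly of_int p') c = 0"
  proof -
    let ?W = "{w :: complex. w ^ m = c}"
    have "0 = (\<Sum>w\<in>?W. w ^ r * poly (map_poly of_int p) w)" using root by simp
    also have "\<dots> = (\<Sum>w\<in>?W. \<Sum>j\<le>degree p. of_int (coeff p j) * w ^ (j + r))"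
      by (simp add: poly_altdef degree_map_poly coeff_map_poly sum_distrib_left power_add mult_ac)
    also have "\<dots> = (\<Sum>j\<le>degree p. of_int (coeff p j) * (\<Sum>w\<in>?W. w ^ (j + r)))"
      by (subst sum.swap) (simp add: sum_distrib_left)
    also have "\<dots> = (\<Sum>j\<in>J. of_int (coeff p j) * (of_nat m * c ^ e j))"
    proof (rule sum.mono_neutral_cong_right)
      show "\<forall>j\<in>{..degree p} - J. of_int (coeff p j) * (\<Sum>w\<in>?W. w ^ (j + r)) = 0"
        using sum_nth_roots_power[OF m] by (simp add: J_def)
      fix j assume "j \<in> J"
      have "(\<Sum>w\<in>?W. w ^ (j + r)) = (\<Sum>w\<in>?W. c ^ e j)"
        by (rule sum.cong) (auto simp: me[OF \<open>j \<in> J\<close>, symmetric] power_mult)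
      then show "of_int (coeff p j) * (\<Sum>w\<in>?W. w ^ (j + r)) = of_int (coeff p j) * (of_nat m * c ^ e j)"
        using card_nth_roots[OF c m] by simp
    qed (auto simp: J_def)
    also have "\<dots> = of_nat m * (\<Sum>j\<in>J. of_int (coeff p j) * c ^ e j)"
      by (simp add: sum_distrib_left mult_ac)
    finally have "(\<Sum>j\<in>J. of_int (coeff p j) * c ^ e j) = 0" using m by simp
    moreover have "poly (map_poly of_int (\<Sum>j\<in>K. monom (coeff p j) (e j))) c =
        (\<Sum>j\<in>K. of_int (coeff p j) * c ^ e j)" if "finite K" for K
      using that
    proof (induction K)
      case (insert j K)
      have "map_poly of_int (a + b) = (map_poly of_int a + map_poly of_int b :: complex poly)" for a b
        by (rule poly_eqI) (simp add: coeff_map_poly)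
      with insert show ?case by (simp add: map_poly_monom poly_monom)
    qed simp
    ultimately show ?thesis using finJ by (simp add: p'_def)
  qed
  ultimately show thesis using that by blast
qed

subsection \<open>Growth of the number of power sums\<close>

text \<open>Generic in the ring: integer coefficients are needed for \<open>unit_poly\<close>,
  rational ones for transfer to conjugates.\<close>

definition set_poly :: "nat set \<Rightarrow> 'a::comm_ring_1 poly" where
  "set_poly S = (\<Sum>k\<in>S. monom 1 k)"

lemma rat_eval_set_poly: "rat_eval (set_poly S) z = (\<Sum>k\<in>S. z ^ k)"
  by (simp add: set_poly_def rat_eval_sum rat_eval_monom)

lemma coeff_set_poly: "finite S \<Longrightarrow> coeff (set_poly S) k = (if k \<in> S then 1 else 0)"
  by (simp add: set_poly_def coeff_sum)

lemma of_rat_of_int_poly: "map_poly of_rat (map_poly of_int p) = (map_poly of_int p :: complex poly)"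
  by (rule poly_eqI) (simp add: coeff_map_poly)

text \<open>A coincidence of two sums at \<open>z\<close> is the vanishing of a rational polynomial,
  which carries over to \<open>w\<close>.\<close>

lemma card_power_sums_conjugate:
  assumes "\<And>r. rat_eval r z = 0 \<Longrightarrow> rat_eval r w = 0"
  shows "card (power_sums n w) \<le> card (power_sums n z)"
  unfolding power_sums_def
proof (rule card_image_le_of_factor)
  fix S T :: "nat set" assume eq: "(\<Sum>k\<in>S. z ^ k) = (\<Sum>k\<in>T. z ^ k)"
  have "rat_eval (set_poly S - set_poly T) z = 0"
    by (simp only: poly_map_of_rat_diff rat_eval_set_poly eq) simp
  then have "rat_eval (set_poly S - set_poly T) w = 0" by (rule assms)
  then show "(\<Sum>k\<in>S. w ^ k) = (\<Sum>k\<in>T. w ^ k)"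
    by (simp only: poly_map_of_rat_diff rat_eval_set_poly) simp
qed simp

lemma card_power_sums_no_unit_poly:
  assumes no: "\<not> (\<exists>p. unit_poly p \<and> poly (map_poly of_int p) (complex_of_real q) = 0)"
  shows "card (power_sums n q) = 2 ^ Suc n"
proof -
  let ?z = "complex_of_real q"
  have "inj_on (\<lambda>S. \<Sum>k\<in>S. ?z ^ k) (Pow {..n})"
  proof (rule inj_onI)
    fix S T assume ST: "S \<in> Pow {..n}" "T \<in> Pow {..n}" and eq: "(\<Sum>k\<in>S. ?z ^ k) = (\<Sum>k\<in>T. ?z ^ k)"
    have fin: "finite S" "finite T" using ST finite_subset by auto
    define p :: "int poly" where "p = set_poly S - set_poly T"
    have co: "coeff p k = (if k \<in> S then 1 else 0) - (if k \<in> T then 1 else 0)" for k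
      using fin by (simp add: p_def coeff_set_poly)
    have "map_poly of_int p = (map_poly of_rat (set_poly S - set_poly T) :: complex poly)"
      by (rule poly_eqI) (use fin in \<open>simp add: coeff_map_poly co coeff_set_poly\<close>)
    then have "poly (map_poly of_int p) ?z = rat_eval (set_poly S - set_poly T) ?z" by simp
    also have "\<dots> = 0" by (simp only: poly_map_of_rat_diff rat_eval_set_poly eq) simp
    finally have "\<not> unit_poly p" using no by blast
    moreover have "coeff p k \<in> {-1, 0, 1}" for k unfolding co by simp
    ultimately have "p = 0" unfolding unit_poly_def by blast
    then have "k \<in> S \<longleftrightarrow> k \<in> T" for k using co[of k] by (auto split: if_splits)
    then show "S = T" by blast
  qed
  then have "card (power_sums n ?z) = 2 ^ Suc n"
    unfolding power_sums_def by (simp add: card_image card_Pow)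
  then show ?thesis by (simp add: card_power_sums_of_real)
qed

text \<open>Exponents congruent to 0 or 1 modulo \<open>m\<close> give sums \<open>u + q * v\<close>
  with \<open>u\<close> and \<open>v\<close> in \<open>power_sums n (q ^ m)\<close>. If
  \<open>u + q * v = u' + q * v'\<close>, then also \<open>u + z * v = u' + z * v'\<close> because
  \<open>z ^ m = q ^ m\<close>, and subtraction gives \<open>(z - q) * (v - v') = 0\<close>.\<close>

lemma card_power_sums_square_le:
  fixes q :: real and z :: complex
  assumes conj: "\<And>r. rat_eval r (complex_of_real q) = 0 \<Longrightarrow> rat_eval r z = 0"
    and z: "z \<noteq> complex_of_real q" "z ^ m = complex_of_real q ^ m" and m: "m \<ge> 2"
  shows "card (power_sums n (complex_of_real q ^ m)) ^ 2 \<le> card (power_sums (m * n + 1) (complex_of_real q))"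
proof -
  let ?q = "complex_of_real q"
  let ?A = "Pow {..n} \<times> Pow {..n}"
  define E where "E w S T = (\<Sum>k\<in>S. w ^ (m * k)) + (\<Sum>k\<in>T. w ^ (m * k + 1))" for w :: complex and S T
  define g where "g = (\<lambda>(S, T). (\<Sum>k\<in>S. (?q ^ m) ^ k, \<Sum>k\<in>T. (?q ^ m) ^ k))"
  have E: "E w S T = (\<Sum>k\<in>S. (w ^ m) ^ k) + w * (\<Sum>k\<in>T. (w ^ m) ^ k)" for w S T
    by (simp add: E_def power_mult sum_distrib_left)
  have "g ` ?A = power_sums n (?q ^ m) \<times> power_sums n (?q ^ m)"
    by (force simp: g_def power_sums_def)
  then have "card (power_sums n (?q ^ m)) ^ 2 = card (g ` ?A)"
    by (simp add: card_cartesian_product power2_eq_square)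
  also have "\<dots> \<le> card ((\<lambda>(S, T). E ?q S T) ` ?A)"
  proof (rule card_image_le_of_factor)
    fix x y assume "(case x of (S, T) \<Rightarrow> E ?q S T) = (case y of (S, T) \<Rightarrow> E ?q S T)"
    moreover obtain S T S' T' where xy: "x = (S, T)" "y = (S', T')" by (metis surj_pair)
    ultimately have eq: "E ?q S T = E ?q S' T'" by simp
    define P :: "nat set \<Rightarrow> nat set \<Rightarrow> rat poly"
      where "P S T = (\<Sum>k\<in>S. monom 1 (m * k)) + (\<Sum>k\<in>T. monom 1 (m * k + 1))" for S T
    have P: "rat_eval (P S T) w = E w S T" for S T w
      by (simp add: P_def E_def rat_eval_add rat_eval_sum rat_eval_monom)
    have "rat_eval (P S T - P S' T') ?q = 0" by (simp add: poly_map_of_rat_diff P eq)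
    then have "rat_eval (P S T - P S' T') z = 0" by (rule conj)
    then have eqz: "E z S T = E z S' T'" by (simp add: poly_map_of_rat_diff P)
    let ?s = "\<lambda>S. \<Sum>k\<in>S. (?q ^ m) ^ k"
    have "(z - ?q) * (?s T - ?s T') = 0"
      using eq eqz unfolding E z(2) by algebra
    then have "?s T = ?s T'" using z(1) by simp
    moreover from this have "?s S = ?s S'" using eq unfolding E by simp
    ultimately show "g x = g y" by (simp add: g_def xy)
  qed simp
  also have "\<dots> \<le> card (power_sums (m * n + 1) ?q)"
  proof (rule card_mono)
    show "(\<lambda>(S, T). E ?q S T) ` ?A \<subseteq> power_sums (m * n + 1) ?q"
    proof clarify
      fix S T assume ST: "S \<subseteq> {..n}" "T \<subseteq> {..n}"
      let ?S = "(\<lambda>k. m * k) ` S" and ?T = "(\<lambda>k. m * k + 1) ` T"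
      have fin: "finite S" "finite T" using ST finite_subset by auto
      have "m * a \<noteq> m * b + 1" for a b
      proof
        assume "m * a = m * b + 1"
        then have "m dvd m * b + 1" by (metis dvd_triv_left)
        then have "m dvd 1" using dvd_add_right_iff[of m "m * b" 1] by simp
        then show False using m by simp
      qed
      then have "?S \<inter> ?T = {}" by auto
      then have "(\<Sum>k\<in>?S \<union> ?T. ?q ^ k) = (\<Sum>k\<in>?S. ?q ^ k) + (\<Sum>k\<in>?T. ?q ^ k)"
        using fin by (intro sum.union_disjoint) auto
      also have "\<dots> = E ?q S T"
        unfolding E_def using m by (simp add: sum.reindex inj_on_def)
      finally have "E ?q S T = (\<Sum>k\<in>?S \<union> ?T. ?q ^ k)" ..
      moreover have "?S \<union> ?T \<subseteq> {..m * n + 1}"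
      proof -
        have "m * k \<le> m * n" if "k \<in> S \<union> T" for k
          using that ST by (intro mult_le_mono2) auto
        then show ?thesis by (auto intro: le_SucI)
      qed
      ultimately show "E ?q S T \<in> power_sums (m * n + 1) ?q"
        by (simp only: power_sumsI)
    qed
  qed simp
  finally show ?thesis .
qed

lemma card_power_sums_unbounded:
  fixes q :: real
  assumes q: "1 < q" "q < 2" and f: "is_min_poly (complex_of_real q) f"
    and z: "rat_eval f z = 0" "z \<noteq> complex_of_real q" "q \<le> cmod z" and C: "C > 0"
  shows "\<exists>n. C * q ^ n < card (power_sums n q)"
proof (cases "\<exists>p. unit_poly p \<and> poly (map_poly of_int p) (complex_of_real q) = 0")
  \<comment> \<open>Here all \<open>2 ^ Suc n\<close> sums are distinct and \<open>q < 2\<close>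
    suffices. The case matters because the lemma is also applied to \<open>q\<^sup>2\<close>, for
    which no such polynomial is assumed.\<close>
  case False
  obtain n where "C < (2 / q) ^ n" using real_arch_pow[of "2 / q" C] q by auto
  then have "C * q ^ n < 2 ^ n" using q by (simp add: field_simps power_divide)
  also have "(2::real) ^ n \<le> 2 ^ Suc n" by simp
  finally show ?thesis using card_power_sums_no_unit_poly[OF False, of n] by (intro exI[of _ n]) simp
next
  case True
  then obtain p where p: "unit_poly p" "poly (map_poly of_int p) (complex_of_real q) = 0" by blast
  note conj = is_min_poly_conjugate[OF f]
  have pw: "poly (map_poly of_int p) w = 0" if "rat_eval f w = 0" for w
    using conj[OF that, of "map_poly of_int p"] p by (simp add: of_rat_of_int_poly)
  show ?thesis
  proof (cases "\<exists>w. rat_eval f w = 0 \<and> cmod w > q")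
    case True
    then obtain w where w: "rat_eval f w = 0" "cmod w > q" by blast
    obtain c :: real where c: "c > 0" "\<And>n. cmod w ^ n \<le> c * card (power_sums n w)"
      using card_power_sums_ge[OF p(1) pw[OF w(1)]] by blast
    obtain n where "C * c < (cmod w / q) ^ n"
      using real_arch_pow[of "cmod w / q" "C * c"] q w by auto
    then have "C * c * q ^ n < cmod w ^ n" using q by (simp add: field_simps power_divide)
    also have "\<dots> \<le> c * card (power_sums n w)" by (rule c)
    also have "\<dots> \<le> c * card (power_sums n q)"
    proof -
      have "card (power_sums n w) \<le> card (power_sums n (complex_of_real q))"
        by (rule card_power_sums_conjugate) (rule conj[OF w(1)])
      then show ?thesis using c by (intro mult_left_mono) (auto simp: card_power_sums_of_real)
    qed
    finally have "c * (C * q ^ n) < c * card (power_sums n q)" by (simp add: mult_ac)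
    then show ?thesis using c(1) by (intro exI[of _ n]) simp
  next
    case False
    then have le: "cmod a \<le> q" if "rat_eval f a = 0" for a using that by force
    define S where "S = {a. rat_eval f a = 0 \<and> cmod a = q}"
    define m where "m = card S"
    have q0: "q > 0" using q by simp
    have S: "S = {w. w ^ m = complex_of_real (q ^ m)}" and "m > 0"
      using max_modulus_conjugates[OF f q0 le] by (simp_all add: S_def m_def)
    have qz: "{complex_of_real q, z} \<subseteq> S"
      using f q z le[of z] by (auto simp: S_def is_min_poly_def)
    have "finite S" using \<open>m > 0\<close> by (simp add: m_def card_ge_0_finite)
    then have "card {complex_of_real q, z} \<le> m" unfolding m_def using qz by (rule card_mono)
    then have m: "m \<ge> 2" using z by simp
    have zm: "z ^ m = complex_of_real q ^ m" using qz S by auto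
    let ?b = "complex_of_real q ^ m"
    \<comment> \<open>All \<open>m\<close>-th roots of \<open>?b\<close> lie in \<open>S\<close>, so
      they are conjugates of \<open>q\<close> and roots of \<open>p\<close>.\<close>
    obtain p' where p': "unit_poly p'" "poly (map_poly of_int p') ?b = 0"
    proof (rule unit_poly_root_power[OF p(1) \<open>m > 0\<close>, of ?b])
      show "?b \<noteq> 0" using q by simp
      show "poly (map_poly of_int p) w = 0" if "w ^ m = ?b" for w
        using that S by (intro pw) (auto simp: S_def)
    qed blast
    obtain c :: real where c: "c > 0" "\<And>n. cmod ?b ^ n \<le> c * card (power_sums n ?b)"
      using card_power_sums_ge[OF p'] by blast
    \<comment> \<open>The number of sums at level \<open>m * n + 1\<close> is at least
      \<open>(q ^ (m * n) / c)\<^sup>2\<close>; this choice makes it exceed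
      \<open>C * q ^ (m * n + 1)\<close>.\<close>
    obtain n where n: "C * q * c\<^sup>2 < q ^ n" using real_arch_pow[of q] q by blast
    have "q ^ n \<le> q ^ (m * n)" using q m by (intro power_increasing) auto
    with n have "C * q * c\<^sup>2 < q ^ (m * n)" by linarith
    then have "C * q * c\<^sup>2 * q ^ (m * n) < q ^ (m * n) * q ^ (m * n)"
      using q by (intro mult_strict_right_mono) auto
    also have "\<dots> = (cmod ?b ^ n)\<^sup>2"
      using q by (simp add: norm_power power2_eq_square power_mult)
    also have "\<dots> \<le> (c * card (power_sums n ?b))\<^sup>2"
      using c(2) by (intro power_mono) auto
    also have "\<dots> = c\<^sup>2 * real (card (power_sums n ?b) ^ 2)" by (simp add: power_mult_distrib)
    also have "\<dots> \<le> c\<^sup>2 * card (power_sums (m * n + 1) q)"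
    proof -
      have "card (power_sums n ?b) ^ 2 \<le> card (power_sums (m * n + 1) (complex_of_real q))"
        by (rule card_power_sums_square_le[OF _ z(2) zm m]) (rule conj[OF z(1)])
      then show ?thesis
        unfolding card_power_sums_of_real by (intro mult_left_mono of_nat_mono) auto
    qed
    finally have "c\<^sup>2 * (C * q ^ (m * n + 1)) < c\<^sup>2 * card (power_sums (m * n + 1) q)"
      by (simp add: mult_ac)
    then show ?thesis using c(1) by (intro exI[of _ "m * n + 1"]) (simp only: mult_less_cancel_left_pos zero_less_power)
  qed
qed

section \<open>Pigeonhole principle: many sums force close pairs\<close>

lemma spec_close_pair:
  fixes q :: real
  assumes q: "1 < q" and unb: "\<And>C. C > 0 \<Longrightarrow> \<exists>n. C * q ^ n < card (power_sums n q)"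
    and e: "\<epsilon> > 0"
  shows "\<exists>x\<in>spec q. \<exists>y\<in>spec q. x < y \<and> y < x + \<epsilon>"
proof (rule ccontr)
  assume "\<not> ?thesis"
  then have sep: "x + \<epsilon> \<le> y" if "x \<in> spec q" "y \<in> spec q" "x < y" for x y
    using that by force
  \<comment> \<open>Chosen so that \<open>B / \<epsilon> + q ^ n = C * q ^ n\<close> for the bound
    \<open>B\<close> on the sums below.\<close>
  define C where "C = q / ((q - 1) * \<epsilon>) + 1"
  have "C > 0" using q e by (simp add: C_def add_pos_pos)
  then obtain n where n: "C * q ^ n < card (power_sums n q)" using unb by blast
  define B where "B = q ^ Suc n / (q - 1)"
  have bd: "0 \<le> x \<and> x \<le> B" if "x \<in> power_sums n q" for x
  proof -
    from that obtain S where S: "S \<subseteq> {..n}" "x = (\<Sum>k\<in>S. q ^ k)" by (auto simp: power_sums_def)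
    have "x \<le> (\<Sum>k\<le>n. q ^ k)" unfolding S using S q by (intro sum_mono2) auto
    also have "\<dots> = (q ^ Suc n - 1) / (q - 1)"
      using q geometric_sum[of q "Suc n"] by (simp add: lessThan_Suc_atMost)
    also have "\<dots> \<le> B" using q by (auto simp: B_def intro!: divide_right_mono)
    finally have "x \<le> B" .
    moreover have "x \<ge> 0" unfolding S using q by (intro sum_nonneg) auto
    ultimately show ?thesis by simp
  qed
  \<comment> \<open>Points at distance at least \<open>\<epsilon>\<close> fall into different cells
    of length \<open>\<epsilon>\<close>.\<close>
  have "inj_on (\<lambda>x. \<lfloor>x / \<epsilon>\<rfloor>) (power_sums n q)"
  proof (rule linorder_inj_onI)
    fix x y assume xy: "x < y" "x \<in> power_sums n q" "y \<in> power_sums n q"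
    then have "x + \<epsilon> \<le> y" using sep power_sums_subset_spec by blast
    then have "(x + \<epsilon>) / \<epsilon> \<le> y / \<epsilon>" using e by (intro divide_right_mono) auto
    then have "x / \<epsilon> + 1 \<le> y / \<epsilon>" using e by (simp add: add_divide_distrib)
    then show "\<lfloor>x / \<epsilon>\<rfloor> \<noteq> \<lfloor>y / \<epsilon>\<rfloor>" by linarith
  qed auto
  moreover have "(\<lambda>x. \<lfloor>x / \<epsilon>\<rfloor>) ` power_sums n q \<subseteq> {0..\<lfloor>B / \<epsilon>\<rfloor>}"
    using bd e by (auto intro!: floor_mono divide_right_mono)
  ultimately have "card (power_sums n q) \<le> card {0..\<lfloor>B / \<epsilon>\<rfloor>}"
    by (intro card_inj_on_le) auto
  then have "real (card (power_sums n q)) \<le> real (nat (\<lfloor>B / \<epsilon>\<rfloor> + 1))" by simp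
  also have "\<dots> \<le> B / \<epsilon> + 1"
  proof -
    have "B / \<epsilon> \<ge> 0" using q e by (simp add: B_def)
    then show ?thesis by linarith
  qed
  also have "\<dots> \<le> B / \<epsilon> + q ^ n" using q by simp
  also have "\<dots> = C * q ^ n" using q e by (simp add: C_def B_def field_simps)
  finally show False using n by simp
qed

subsection \<open>Gaps\<close>

lemma spec_enum_gap_le:
  assumes "q > 1" "x \<in> spec q" "spec_enum q n < x"
  shows "spec_enum q (Suc n) \<le> x"
  using spec_next(3)[OF assms] by simp

lemma gap_liminf_eq_0:
  assumes q: "q > 1" and close: "\<And>\<epsilon>. \<epsilon> > 0 \<Longrightarrow> \<exists>x\<in>spec q. \<exists>y\<in>spec q. x < y \<and> y < x + \<epsilon>"
  shows "gap_liminf q = 0"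
proof -
  define g where "g n = spec_enum q (Suc n) - spec_enum q n" for n
  note mono = strict_mono_spec_enum[OF q]
  have gpos: "g n > 0" for n using strict_monoD[OF mono, of n "Suc n"] by (simp add: g_def del: spec_enum.simps)
  have small: "\<exists>n\<ge>N. g n < \<epsilon>" if "\<epsilon> > 0" for \<epsilon> N
  proof -
    \<comment> \<open>Being at most each of the first \<open>N\<close> gaps, \<open>\<delta>\<close>
      forces the close pair to start at an index from \<open>N\<close> on.\<close>
    define \<delta> where "\<delta> = Min (insert \<epsilon> (g ` {..<N}))"
    have "\<delta> > 0" using that gpos by (auto simp: \<delta>_def)
    then obtain x y where xy: "x \<in> spec q" "y \<in> spec q" "x < y" "y < x + \<delta>" using close by blast
    then obtain i where i: "x = spec_enum q i" using range_spec_enum[OF q] by (metis imageE)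
    have "g i < \<delta>" using spec_enum_gap_le[OF q xy(2), of i] xy i by (simp add: g_def del: spec_enum.simps)
    moreover have "\<delta> \<le> \<epsilon>" by (simp add: \<delta>_def)
    moreover have "\<delta> \<le> g i" if "i < N" using that by (simp add: \<delta>_def)
    ultimately show ?thesis by (intro exI[of _ i]) force
  qed
  have "liminf (\<lambda>n. ereal (g n)) = 0"
  proof (rule antisym)
    show "0 \<le> liminf (\<lambda>n. ereal (g n))"
      by (rule Liminf_bounded) (use gpos in \<open>auto simp: less_imp_le\<close>)
    show "liminf (\<lambda>n. ereal (g n)) \<le> 0"
    proof (rule ccontr)
      assume "\<not> liminf (\<lambda>n. ereal (g n)) \<le> 0"
      then obtain e where e: "0 < ereal e" "ereal e < liminf (\<lambda>n. ereal (g n))"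
        using ereal_dense2[of 0 "liminf (\<lambda>n. ereal (g n))"] by (auto simp: not_le)
      from less_LiminfD[OF e(2)] obtain N where "\<And>n. n \<ge> N \<Longrightarrow> e < g n"
        by (auto simp: eventually_sequentially)
      then show False using small[of e N] e(1) by force
    qed
  qed
  then show ?thesis by (simp add: gap_liminf_def g_def del: spec_enum.simps)
qed

lemma gap_limsup_eq_0:
  assumes q: "q > 1" and dense: "\<And>\<epsilon>. \<epsilon> > 0 \<Longrightarrow> \<exists>R. \<forall>x\<ge>R. \<exists>y\<in>spec q. x < y \<and> y \<le> x + \<epsilon>"
  shows "gap_limsup q = 0"
proof -
  define g where "g n = spec_enum q (Suc n) - spec_enum q n" for n
  note mono = strict_mono_spec_enum[OF q]
  have gpos: "g n > 0" for n using strict_monoD[OF mono, of n "Suc n"] by (simp add: g_def del: spec_enum.simps)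
  have "g \<longlonglongrightarrow> 0"
  proof (rule LIMSEQ_I)
    fix \<epsilon> :: real assume "\<epsilon> > 0"
    then obtain R where R: "\<forall>x\<ge>R. \<exists>y\<in>spec q. x < y \<and> y \<le> x + \<epsilon> / 2"
      using dense[of "\<epsilon> / 2"] by auto
    obtain b where "b \<in> spec q" "R < b" using spec_unbounded[OF q] by blast
    then obtain N where N: "R < spec_enum q N" using range_spec_enum[OF q] by (metis imageE)
    have "norm (g n - 0) < \<epsilon>" if "n \<ge> N" for n
    proof -
      have "R \<le> spec_enum q n" using N that strict_mono_less_eq[OF mono, of N n] by linarith
      then obtain y where y: "y \<in> spec q" "spec_enum q n < y" "y \<le> spec_enum q n + \<epsilon> / 2" using R by blast
      then have "g n \<le> \<epsilon> / 2" using spec_enum_gap_le[OF q y(1,2)] by (simp add: g_def del: spec_enum.simps)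
      then show ?thesis using gpos[of n] \<open>\<epsilon> > 0\<close> by simp
    qed
    then show "\<exists>N. \<forall>n\<ge>N. norm (g n - 0) < \<epsilon>" by blast
  qed
  then have "(\<lambda>n. ereal (g n)) \<longlonglongrightarrow> ereal 0" by (rule tendsto_ereal)
  then have "limsup (\<lambda>n. ereal (g n)) = ereal 0" by (intro lim_imp_Limsup) auto
  then show ?thesis by (simp add: gap_limsup_def g_def zero_ereal_def del: spec_enum.simps)
qed

section \<open>Covering a half-line by translated chains\<close>

lemma spec_floor:
  assumes b: "1 < b" "b < 2" and x: "x \<ge> 0"
  shows "\<exists>y\<in>spec b. y \<le> x \<and> x < y + 1"
proof -
  have "\<exists>S\<subseteq>{..<n}. (\<Sum>k\<in>S. b ^ k) \<le> x \<and> x < (\<Sum>k\<in>S. b ^ k) + 1" if "0 \<le> x" "x < b ^ n" for n x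
    using that
  proof (induction n arbitrary: x)
    case 0
    then show ?case by auto
  next
    case (Suc n)
    show ?case
    proof (cases "x < b ^ n")
      case True
      then show ?thesis using Suc.IH[of x] Suc.prems by (meson lessThan_subset_iff le_SucI order_refl order_trans)
    next
      case False
      \<comment> \<open>Greedy expansion: as \<open>b < 2\<close>, removing \<open>b ^ n\<close>
        once leaves a remainder below \<open>b ^ n\<close>.\<close>
      have "b ^ n * b \<le> b ^ n * 2" using b by (intro mult_left_mono) auto
      then have "x - b ^ n < b ^ n" using Suc.prems by (simp add: mult.commute)
      then obtain S where S: "S \<subseteq> {..<n}" "(\<Sum>k\<in>S. b ^ k) \<le> x - b ^ n" "x - b ^ n < (\<Sum>k\<in>S. b ^ k) + 1"
        using Suc.IH[of "x - b ^ n"] False by auto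
      have "finite S" "n \<notin> S" using S(1) finite_subset by auto
      then show ?thesis using S by (intro exI[of _ "insert n S"]) auto
    qed
  qed
  moreover obtain n where "x < b ^ n" using real_arch_pow[OF b(1)] by blast
  ultimately obtain S where "S \<subseteq> {..<n}" "(\<Sum>k\<in>S. b ^ k) \<le> x" "x < (\<Sum>k\<in>S. b ^ k) + 1"
    using x by blast
  moreover from this have "(\<Sum>k\<in>S. b ^ k) \<in> spec b"
    unfolding mem_spec_iff by (intro exI[of _ S]) (auto intro: finite_subset)
  ultimately show ?thesis by blast
qed

text \<open>A close pair times a suitable power of \<open>b\<close> has distance in the window from
  \<open>\<epsilon> / b\<close> to \<open>\<epsilon>\<close>. Adding its lower point to the whole
  old chain keeps the gaps, and adding its upper point to the last element appends one more. The
  lower bound on the steps makes long chains wide.\<close>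

lemma spec_chain:
  assumes b: "b > 1" and close: "\<And>\<epsilon>. \<epsilon> > 0 \<Longrightarrow> \<exists>x\<in>spec b. \<exists>y\<in>spec b. x < y \<and> y < x + \<epsilon>"
    and e: "\<epsilon> > 0"
  shows "\<exists>s. (\<forall>i\<le>M. s i \<in> spec b) \<and> (\<forall>i<M. \<epsilon> / b \<le> s (Suc i) - s i \<and> s (Suc i) - s i \<le> \<epsilon>)"
proof (induction M)
  case 0
  show ?case by (intro exI[of _ "\<lambda>_. 0"]) (simp add: zero_in_spec)
next
  case (Suc M)
  then obtain s where s: "\<forall>i\<le>M. s i \<in> spec b"
    "\<forall>i<M. \<epsilon> / b \<le> s (Suc i) - s i \<and> s (Suc i) - s i \<le> \<epsilon>" by blast
  have "\<forall>i\<le>M. \<exists>S. finite S \<and> s i = (\<Sum>k\<in>S. b ^ k)" using s(1) by (simp add: mem_spec_iff)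
  then obtain S where S: "\<And>i. i \<le> M \<Longrightarrow> finite (S i) \<and> s i = (\<Sum>k\<in>S i. b ^ k)" by metis
  \<comment> \<open>All exponents used so far lie below \<open>n\<close>. If there are none, the
    value of \<open>Max\<close> is irrelevant.\<close>
  define n where "n = Suc (Max (\<Union>i\<le>M. S i))"
  have Sn: "k < n" if "k \<in> S i" "i \<le> M" for k i
    unfolding n_def less_Suc_eq_le using that S by (intro Max_ge) auto
  \<comment> \<open>The distance is so small that \<open>\<xi> * b ^ n < \<epsilon>\<close>; this
    forces \<open>n \<le> j\<close>, so the scaled pair uses fresh exponents only.\<close>
  obtain x y where xy: "x \<in> spec b" "y \<in> spec b" "x < y" "y < x + \<epsilon> / b ^ n"
    using close[of "\<epsilon> / b ^ n"] e b by auto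
  define \<xi> where "\<xi> = y - x"
  have \<xi>: "0 < \<xi>" "\<xi> < \<epsilon> / b ^ n" using xy by (auto simp: \<xi>_def)
  \<comment> \<open>The defining inequality divided by \<open>b\<close> is the lower bound for
    \<open>\<xi> * b ^ j\<close>; minimality gives the upper one.\<close>
  define j where "j = (LEAST j. \<epsilon> \<le> \<xi> * b ^ Suc j)"
  have ex: "\<exists>j. \<epsilon> \<le> \<xi> * b ^ Suc j"
  proof -
    obtain j where "\<epsilon> / \<xi> < b ^ j" using real_arch_pow[OF b] by blast
    also have "b ^ j \<le> b ^ Suc j" using b by (intro power_increasing) auto
    finally show ?thesis using \<xi> by (intro exI[of _ j]) (simp add: field_simps)
  qed
  have j1: "\<epsilon> \<le> \<xi> * b ^ Suc j" unfolding j_def by (rule LeastI_ex[OF ex])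
  have nj: "n \<le> j"
  proof (rule ccontr)
    assume "\<not> n \<le> j"
    then have "b ^ Suc j \<le> b ^ n" using b by (intro power_increasing) auto
    then have "\<xi> * b ^ Suc j \<le> \<xi> * b ^ n" using \<xi> by (intro mult_left_mono) auto
    also have "\<dots> < \<epsilon>" using \<xi> b by (simp add: field_simps)
    finally show False using j1 by simp
  qed
  have j2: "\<xi> * b ^ j \<le> \<epsilon>"
  proof (cases j)
    case 0
    then show ?thesis using \<xi> nj by simp
  next
    case (Suc i)
    then have "\<not> \<epsilon> \<le> \<xi> * b ^ Suc i" using not_less_Least[of i "\<lambda>j. \<epsilon> \<le> \<xi> * b ^ Suc j"] by (simp add: j_def)
    then show ?thesis by (simp add: Suc)
  qed
  have add: "s i + u * b ^ j \<in> spec b" if iM: "i \<le> M" and u: "u \<in> spec b" for i u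
  proof -
    obtain U where U: "finite U" "u = (\<Sum>k\<in>U. b ^ k)" using u by (auto simp: mem_spec_iff)
    let ?V = "(\<lambda>k. k + j) ` U"
    have "S i \<inter> ?V = {}" using Sn[OF _ iM] nj by force
    then have "(\<Sum>k\<in>S i \<union> ?V. b ^ k) = s i + (\<Sum>k\<in>?V. b ^ k)"
      using S[OF iM] U by (subst sum.union_disjoint) auto
    also have "(\<Sum>k\<in>?V. b ^ k) = u * b ^ j"
      unfolding U(2) by (subst sum.reindex) (auto simp: inj_on_def power_add sum_distrib_right)
    finally show ?thesis
      unfolding mem_spec_iff using S[OF iM] U by (intro exI[of _ "S i \<union> ?V"]) auto
  qed
  define s' where "s' i = (if i \<le> M then s i + x * b ^ j else s M + y * b ^ j)" for i
  have "\<forall>i\<le>Suc M. s' i \<in> spec b" using add xy by (auto simp: s'_def)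
  moreover have "\<epsilon> / b \<le> s' (Suc i) - s' i \<and> s' (Suc i) - s' i \<le> \<epsilon>" if "i < Suc M" for i
  proof (cases "i = M")
    case True
    have "s' (Suc i) - s' i = \<xi> * b ^ j" using True by (simp add: s'_def \<xi>_def algebra_simps)
    moreover have "\<epsilon> / b \<le> \<xi> * b ^ j" using j1 b by (simp add: field_simps)
    ultimately show ?thesis using j2 by simp
  next
    case False
    then show ?thesis using that s(2) by (simp add: s'_def)
  qed
  ultimately show ?case by blast
qed

lemma spec_square_add:
  assumes "x \<in> spec (q\<^sup>2)" "y \<in> spec (q\<^sup>2)"
  shows "x + q * y \<in> spec q"
proof -
  obtain S T where S: "finite S" "x = (\<Sum>k\<in>S. (q\<^sup>2) ^ k)" and T: "finite T" "y = (\<Sum>k\<in>T. (q\<^sup>2) ^ k)"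
    using assms by (auto simp: mem_spec_iff)
  let ?S = "(\<lambda>k. 2 * k) ` S" and ?T = "(\<lambda>k. 2 * k + 1) ` T"
  have "?S \<inter> ?T = {}" by (auto, presburger)
  then have "(\<Sum>k\<in>?S \<union> ?T. q ^ k) = (\<Sum>k\<in>?S. q ^ k) + (\<Sum>k\<in>?T. q ^ k)"
    using S T by (intro sum.union_disjoint) auto
  also have "(\<Sum>k\<in>?S. q ^ k) = x"
    unfolding S(2) by (subst sum.reindex) (auto simp: inj_on_def power_mult)
  also have "(\<Sum>k\<in>?T. q ^ k) = q * y"
    unfolding T(2) by (subst sum.reindex) (auto simp: inj_on_def power_mult sum_distrib_left)
  finally show ?thesis unfolding mem_spec_iff using S T by (intro exI[of _ "?S \<union> ?T"]) auto
qed

lemma spec_dense_of_square: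
  fixes q :: real
  assumes q: "q > 1" "q\<^sup>2 < 2"
    and close: "\<And>\<epsilon>. \<epsilon> > 0 \<Longrightarrow> \<exists>x\<in>spec (q\<^sup>2). \<exists>y\<in>spec (q\<^sup>2). x < y \<and> y < x + \<epsilon>"
    and e: "\<epsilon> > 0"
  shows "\<exists>R. \<forall>x\<ge>R. \<exists>y\<in>spec q. x < y \<and> y \<le> x + \<epsilon>"
proof -
  define b where "b = q\<^sup>2"
  have b: "1 < b" "b < 2" using q by (auto simp: b_def)
  \<comment> \<open>\<open>M\<close> steps of length at least \<open>\<epsilon> / b\<close> span
    more than \<open>q\<close>.\<close>
  obtain M :: nat where M: "q * b / \<epsilon> < M" using reals_Archimedean2 by blast
  then have M': "q < M * (\<epsilon> / b)" using b e by (simp add: field_simps)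
  obtain s where s: "\<And>i. i \<le> M \<Longrightarrow> s i \<in> spec b"
    "\<And>i. i < M \<Longrightarrow> \<epsilon> / b \<le> s (Suc i) - s i \<and> s (Suc i) - s i \<le> \<epsilon>"
    using spec_chain[OF b(1) close[folded b_def] e, of M] by blast
  have grow: "s 0 + i * (\<epsilon> / b) \<le> s i" if "i \<le> M" for i
    using that
  proof (induction i)
    case (Suc i)
    then show ?case using s(2)[of i] by (simp add: algebra_simps)
  qed simp
  have "\<exists>y\<in>spec q. x < y \<and> y \<le> x + \<epsilon>" if x: "x \<ge> s 0" for x
  proof -
    obtain y where y: "y \<in> spec b" "y \<le> (x - s 0) / q" "(x - s 0) / q < y + 1"
      using spec_floor[OF b, of "(x - s 0) / q"] x q by auto
    \<comment> \<open>Translating by \<open>q * y\<close> moves \<open>x\<close> into the interval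
      of length \<open>q\<close> that starts at \<open>s 0\<close>, which the chain spans.\<close>
    define t where "t = x - q * y"
    have t: "s 0 \<le> t" "t < s 0 + q" using y q by (simp_all add: t_def field_simps)
    then have "t < s M" using grow[of M] M' by linarith
    \<comment> \<open>The first chain point above \<open>t\<close>. It is not \<open>s 0\<close>,
      and its predecessor is at most \<open>t\<close>, so it exceeds \<open>t\<close> by at most
      \<open>\<epsilon>\<close>.\<close>
    define i where "i = (LEAST i. t < s i)"
    have i1: "t < s i" unfolding i_def by (rule LeastI[of _ M]) fact
    have iM: "i \<le> M" unfolding i_def by (rule Least_le) fact
    obtain k where k: "i = Suc k" using i1 t by (cases i) auto
    then have "\<not> t < s k" using not_less_Least[of k "\<lambda>i. t < s i"] by (simp add: i_def)
    then have "s i \<le> t + \<epsilon>" using s(2)[of k] iM k by simp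
    moreover have "s i + q * y \<in> spec q"
      using spec_square_add s(1)[OF iM] y(1) by (simp add: b_def)
    ultimately show ?thesis using i1 by (intro bexI[of _ "s i + q * y"]) (auto simp: t_def)
  qed
  then show ?thesis by blast
qed

section \<open>Conclusion for \<open>q\<close> and passage to \<open>q\<^sup>2\<close>\<close>

lemma is_min_poly_min_poly: "algebraic z \<Longrightarrow> is_min_poly z (min_poly z)"
  unfolding min_poly_def by (rule theI'[OF ex1_is_min_poly])

lemma spec_close_pair_of_conjugate:
  fixes q :: real
  assumes "1 < q" "q < 2" "is_min_poly (complex_of_real q) f"
    and "rat_eval f z = 0" "z \<noteq> complex_of_real q" "q \<le> cmod z" "\<epsilon> > 0"
  shows "\<exists>x\<in>spec q. \<exists>y\<in>spec q. x < y \<and> y < x + \<epsilon>"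
  using spec_close_pair[OF assms(1) card_power_sums_unbounded[OF assms(1-6)] assms(7)] .

lemma rat_eval_square: "rat_eval (pcompose r (monom 1 2)) z = rat_eval r (z\<^sup>2)"
  by (simp add: rat_eval_pcompose rat_eval_monom)

text \<open>The squares of the conjugates have rational power sums, so some rational polynomial
  vanishes exactly at these finitely many squares.\<close>

lemma algebraic_square:
  assumes f: "is_min_poly z f"
  shows "algebraic (z\<^sup>2)"
proof -
  let ?A = "{a. rat_eval f a = 0}"
  have "map_poly of_rat f \<noteq> (0 :: complex poly)"
    using f by (auto simp: is_min_poly_def map_poly_eq_0_iff)
  then have fin: "finite ?A" by (rule poly_roots_finite)
  have "(\<Sum>a\<in>?A. a ^ k) \<in> \<rat>" for k
    by (rule Rats_root_power_sum[OF fin]) (simp add: is_min_poly_roots[OF f] coeff_map_poly)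
  from this[of "2 * k" for k] have "(\<Sum>a\<in>?A. (a\<^sup>2) ^ k) \<in> \<rat>" for k
    by (simp add: power_mult)
  from rational_poly_of_power_sums[OF fin this]
  obtain R where R: "\<And>x. rat_eval R x = 0 \<longleftrightarrow> x \<in> (\<lambda>a. a\<^sup>2) ` ?A" by blast
  have "map_poly of_rat R \<noteq> (0 :: complex poly)"
  proof
    assume "map_poly of_rat R = (0 :: complex poly)"
    then have "(\<lambda>a. a\<^sup>2) ` ?A = UNIV" using R by auto
    then show False using fin infinite_UNIV_char_0[where ?'a = complex] by (metis finite_imageI)
  qed
  moreover have "rat_eval R (z\<^sup>2) = 0" using f unfolding R by (auto simp: is_min_poly_def)
  moreover have "\<forall>i. coeff (map_poly of_rat R) i \<in> (\<rat> :: complex set)" by (simp add: coeff_map_poly)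
  ultimately show ?thesis unfolding algebraic_altdef by blast
qed

lemma unit_poly_root_algebraic_int:
  fixes q :: real
  assumes "unit_poly p" "poly (map_poly of_int p) q = 0"
  shows "algebraic_int q"
proof -
  define P where "P = smult (lead_coeff p) p"
  have "lead_coeff p * lead_coeff p = 1" by (rule unit_poly_lead_coeff[OF assms(1)])
  then have "lead_coeff P = 1" using assms(1) by (auto simp: P_def unit_poly_def)
  moreover have "map_poly of_int P = (smult (of_int (lead_coeff p)) (map_poly of_int p) :: real poly)"
    by (rule poly_eqI) (simp add: P_def coeff_map_poly)
  then have "poly (map_poly of_int P) q = 0" using assms(2) by simp
  ultimately show ?thesis by (auto simp: algebraic_int_altdef_ipoly)
qed

theorem theorem2p1:
  fixes q :: real
  assumes "1 < q" and "q < 2"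
    and "\<exists>p :: int poly. p \<noteq> 0 \<and> (\<forall>i. coeff p i \<in> {-1, 0, 1}) \<and> poly (map_poly of_int p) q = 0"
    and "\<not> perron_number q"
  shows "gap_liminf q = 0 \<and>
    (q < sqrt 2 \<and> - complex_of_real q \<notin> conjugates (complex_of_real q) \<longrightarrow> gap_limsup q = 0)"
proof -
  let ?q = "complex_of_real q"
  obtain p where p: "unit_poly p" "poly (map_poly of_int p) q = 0"
    using assms(3) unfolding unit_poly_def by blast
  have int: "algebraic_int q" by (rule unit_poly_root_algebraic_int[OF p])
  then have "algebraic ?q" by (intro algebraic_int_imp_algebraic) simp
  then have f: "is_min_poly ?q (min_poly ?q)" by (rule is_min_poly_min_poly)
  \<comment> \<open>As \<open>q\<close> is an algebraic integer above 1, only a conjugate of modulus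
    at least \<open>q\<close> can keep it from being a Perron number.\<close>
  obtain z where z: "rat_eval (min_poly ?q) z = 0" "z \<noteq> ?q" "q \<le> cmod z"
    using assms(1,4) int unfolding perron_number_def conjugates_def by force
  have "gap_liminf q = 0"
    using assms(1) spec_close_pair_of_conjugate[OF assms(1,2) f z] by (rule gap_liminf_eq_0)
  moreover have "gap_limsup q = 0"
    if q2: "q < sqrt 2" and neg: "- ?q \<notin> conjugates ?q"
  proof -
    have sq: "1 < q\<^sup>2" "q\<^sup>2 < 2"
      using assms(1) q2 real_less_rsqrt[of q] power_strict_mono[OF q2, of 2] by auto
    have "algebraic (complex_of_real (q\<^sup>2))"
      using algebraic_square[OF f] by simp
    then have f2: "is_min_poly (complex_of_real (q\<^sup>2)) (min_poly (complex_of_real (q\<^sup>2)))" (is "is_min_poly ?b ?g")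
      by (rule is_min_poly_min_poly)
    \<comment> \<open>Composing with the square gives a rational polynomial vanishing at
      \<open>q\<close>, hence at \<open>z\<close>; so \<open>z\<^sup>2\<close> is a conjugate of
      \<open>q\<^sup>2\<close>.\<close>
    have "rat_eval (pcompose ?g (monom 1 2)) ?q = 0"
      using f2 by (simp add: rat_eval_square is_min_poly_def)
    then have root: "rat_eval ?g (z\<^sup>2) = 0"
      using is_min_poly_conjugate[OF f z(1)] by (metis rat_eval_square)
    \<comment> \<open>The hypothesis on \<open>-q\<close> keeps \<open>z\<^sup>2\<close> different
      from \<open>q\<^sup>2\<close>, so close pairs also exist in
      \<open>spec (q\<^sup>2)\<close>.\<close>
    have "z \<noteq> - ?q" using neg z(1) by (auto simp: conjugates_def)
    then have ne: "z\<^sup>2 \<noteq> ?b" using z(2) by (simp add: power2_eq_iff)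
    have ge: "q\<^sup>2 \<le> cmod (z\<^sup>2)" using z(3) assms(1) by (simp add: norm_power power_mono)
    show ?thesis
      using assms(1) spec_dense_of_square[OF assms(1) sq(2) spec_close_pair_of_conjugate[OF sq f2 root ne ge]]
      by (rule gap_limsup_eq_0)
  qed
  ultimately show ?thesis by blast
qed

end
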